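(* Let $A\in\mathbb{R}^{n\times n}$ and $C_0,\bar B,\bar C\in\mathbb{R}^{n\times m}$, and for each integer $D\ge0$ let $[A,C_0;\bar B,\bar C]_D$ denote the system $$x_{t+1}=Ax_t+\omega_t^0C_0u_t+(\bar B+\omega_t^D\bar C)u_{t-D},\qquad t\ge0.$$ Assume: 1. $A$ is invertible and unstable; 2. $[A,C_0;\bar B,\bar C]_0$ is asymptotically mean-square stabilizable, and the delay-free system $x_{t+1}=Ax_t+\omega_t^0C_0u_t$ is not asymptotically mean-square stabilizable. Then there exists a unique delay margin $D_{\max}\ge0$ such that $[A,C_0;\bar B,\bar C]_D$ is asymptotically mean-square stabilizable for every integer $D$ with $0\le D\le D_{\max}$, and is not asymptotically mean-square stabilizable for each integer $D>D_{\max}$.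
   Context: Primes denote transposes and $\mathbf{E}$ denotes expectation. $x_t\in\mathbb{R}^n$ is the state and $u_t\in\mathbb{R}^m$ the control input; the initial data $x_0$ and $u_t$, $t=-D,\dots,-1$, are given a priori (deterministic). "Unstable" means that $A$ has an eigenvalue of modulus at least $1$. The delay margin $D_{\max}$ takes values in $\{0,1,2,\dots\}\cup\{+\infty\}$. Noise: $\{\omega_t^0\}_{t\ge 0}$ and $\{\omega_t^D\}_{t\ge 0}$ are two mutually independent real random sequences, each independent and identically distributed in time, with zero mean and $\mathbf{E}(\omega_t^0\omega_s^0)=\sigma_0^2\delta_{ts}$, $\mathbf{E}(\omega_t^D\omega_s^D)=\sigma_D^2\delta_{ts}$ ($\delta_{ts}$ the Kronecker delta). The superscript $D$ labels the noise channel attached to the delayed input; the variances $\sigma_0^2,\sigma_D^2$ are fixed numbers not varying with the delay $D$, and the two channels are distinct also when $D=0$. $\mathcal{F}_t$ is the $\sigma$-algebra generated by both noises at times $0,\dots,t$. Admissible controls: $\mathcal{U}_{ad}$ is the set of control processes $u$ such that $u_t$ is $\mathcal{F}_t$-measurable, $\sum_{t=0}^\infty\mathbf{E}(u_t'u_t)<\infty$, and $u_t=K_0x_t+\sum_{\tau=1}^DK_\tau u_{t-\tau}$ for all $t\ge 0$, for some constant matrices $K_0,\dots,K_D$ of compatible dimensions ($u_t=K_0x_t$ for a delay-free system). Stabilizability: a system is asymptotically mean-square stabilizable if there exists a feedback control law (constant gains) in $\mathcal{U}_{ad}$ such that the closed-loop system satisfies $\lim_{t\to\infty}\mathbf{E}(x_t'x_t)=0$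 for any initial values $x_0$ and $u_t$, $t=-D,\dots,-1$. *)

theory Defs
  imports "HOL-Probability.Probability" "HOL-Library.Extended_Nat"
begin

definition unstable :: "real^'n^'n \<Rightarrow> bool" where
  "unstable A \<longleftrightarrow> (\<exists>(\<mu>::complex) (v::complex^'n).
     v \<noteq> 0 \<and> map_matrix complex_of_real A *v v = \<mu> *s v \<and> cmod \<mu> \<ge> 1)"

(* The two noise channels stay distinct whatever the delay is, and neither their laws nor their
   variances depend on it: the D in wD and \<sigma>D is only a label. *)
locale noise_channels = prob_space M
  for M :: "'a measure" +
  fixes w0 wD :: "nat \<Rightarrow> 'a \<Rightarrow> real"
    and \<sigma>0 \<sigma>D :: real
  assumes indep_w0: "indep_vars (\<lambda>_. borel) w0 UNIV"
    and indep_wD: "indep_vars (\<lambda>_. borel) wD UNIV"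
    and indep_w0_wD: "indep_var (\<Pi>\<^sub>M t\<in>UNIV. borel) (\<lambda>\<omega> t. w0 t \<omega>)
                                (\<Pi>\<^sub>M t\<in>UNIV. borel) (\<lambda>\<omega> t. wD t \<omega>)"
    and identical_w0: "distr M borel (w0 t) = distr M borel (w0 s)"
    and identical_wD: "distr M borel (wD t) = distr M borel (wD s)"
    and square_integrable_w0: "integrable M (\<lambda>\<omega>. (w0 t \<omega>)\<^sup>2)"
    and square_integrable_wD: "integrable M (\<lambda>\<omega>. (wD t \<omega>)\<^sup>2)"
    and mean_w0: "expectation (w0 t) = 0"
    and mean_wD: "expectation (wD t) = 0"
    and cov_w0: "expectation (\<lambda>\<omega>. w0 t \<omega> * w0 s \<omega>) = (if t = s then \<sigma>0\<^sup>2 else 0)"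
    and cov_wD: "expectation (\<lambda>\<omega>. wD t \<omega> * wD s \<omega>) = (if t = s then \<sigma>D\<^sup>2 else 0)"

definition noise_filtration ::
  "'a measure \<Rightarrow> (nat \<Rightarrow> 'a \<Rightarrow> real) \<Rightarrow> (nat \<Rightarrow> 'a \<Rightarrow> real) \<Rightarrow> nat \<Rightarrow> 'a measure" where
  "noise_filtration M w0 wD t = sigma (space M)
     (\<Union>s\<le>t. {w0 s -` S \<inter> space M |S. S \<in> sets borel} \<union> {wD s -` S \<inter> space M |S. S \<in> sets borel})"

(* E(X'X) as an extended nonnegative real, so that a non-integrable X'X has value infinity;
   the Bochner integral would give it the value 0. *)
definition mean_square :: "'a measure \<Rightarrow> ('a \<Rightarrow> real^'k) \<Rightarrow> ennreal" where
  "mean_square M X = (\<integral>\<^sup>+\<omega>. ennreal (X \<omega> \<bullet> X \<omega>) \<partial>M)"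

(* Controls are indexed by integer times, so that the initial data are u at times -D, ..., -1.
   The gain of x is K0 and that of u at time t - \<tau> is K \<tau>, for \<tau> = 1, ..., D. *)
definition feedback_law ::
  "'a measure \<Rightarrow> nat \<Rightarrow> real^'n^'m \<Rightarrow> (nat \<Rightarrow> real^'m^'m)
    \<Rightarrow> (nat \<Rightarrow> 'a \<Rightarrow> real^'n) \<Rightarrow> (int \<Rightarrow> 'a \<Rightarrow> real^'m) \<Rightarrow> bool" where
  "feedback_law M D K0 K x u \<longleftrightarrow> (\<forall>t::nat. \<forall>\<omega>\<in>space M.
     u (int t) \<omega> = K0 *v x t \<omega> + (\<Sum>\<tau>=1..D. K \<tau> *v u (int t - int \<tau>) \<omega>))"

definition admissible_control ::
  "'a measure \<Rightarrow> (nat \<Rightarrow> 'a \<Rightarrow> real) \<Rightarrow> (nat \<Rightarrow> 'a \<Rightarrow> real) \<Rightarrow> nat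
    \<Rightarrow> real^'n^'m \<Rightarrow> (nat \<Rightarrow> real^'m^'m)
    \<Rightarrow> (nat \<Rightarrow> 'a \<Rightarrow> real^'n) \<Rightarrow> (int \<Rightarrow> 'a \<Rightarrow> real^'m) \<Rightarrow> bool" where
  "admissible_control M w0 wD D K0 K x u \<longleftrightarrow>
     (\<forall>t::nat. u (int t) \<in> borel_measurable (noise_filtration M w0 wD t)) \<and>
     (\<Sum>t::nat. mean_square M (u (int t))) < \<infinity> \<and>
     feedback_law M D K0 K x u"

(* Right-hand sides of the state equations: \<xi> is the current state x_t and \<upsilon> is the realised
   control path. *)
definition delayed_dynamics ::
  "real^'n^'n \<Rightarrow> real^'m^'n \<Rightarrow> real^'m^'n \<Rightarrow> real^'m^'n \<Rightarrow> (nat \<Rightarrow> 'a \<Rightarrow> real) \<Rightarrow> (nat \<Rightarrow> 'a \<Rightarrow> real)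
    \<Rightarrow> nat \<Rightarrow> nat \<Rightarrow> 'a \<Rightarrow> real^'n \<Rightarrow> (int \<Rightarrow> real^'m) \<Rightarrow> real^'n" where
  "delayed_dynamics A C0 B C w0 wD D t \<omega> \<xi> \<upsilon> =
     A *v \<xi> + w0 t \<omega> *\<^sub>R (C0 *v \<upsilon> (int t)) + (B + wD t \<omega> *\<^sub>R C) *v \<upsilon> (int t - int D)"

definition delay_free_dynamics ::
  "real^'n^'n \<Rightarrow> real^'m^'n \<Rightarrow> (nat \<Rightarrow> 'a \<Rightarrow> real)
    \<Rightarrow> nat \<Rightarrow> 'a \<Rightarrow> real^'n \<Rightarrow> (int \<Rightarrow> real^'m) \<Rightarrow> real^'n" where
  "delay_free_dynamics A C0 w0 t \<omega> \<xi> \<upsilon> = A *v \<xi> + w0 t \<omega> *\<^sub>R (C0 *v \<upsilon> (int t))"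

(* The gains are chosen before the initial data. For given gains and initial data the feedback
   law and the state equation determine x at times 0, 1, ... and u at times -D, -D+1, ...
   uniquely on space M, so "there are x and u" here means "the closed-loop trajectory
   satisfies". *)
definition ms_stabilizable ::
  "'a measure \<Rightarrow> (nat \<Rightarrow> 'a \<Rightarrow> real) \<Rightarrow> (nat \<Rightarrow> 'a \<Rightarrow> real) \<Rightarrow> nat
    \<Rightarrow> (nat \<Rightarrow> 'a \<Rightarrow> real^'n \<Rightarrow> (int \<Rightarrow> real^'m) \<Rightarrow> real^'n) \<Rightarrow> bool" where
  "ms_stabilizable M w0 wD D f \<longleftrightarrow>
     (\<exists>(K0::real^'n^'m) (K::nat \<Rightarrow> real^'m^'m).
        \<forall>(\<xi>0::real^'n) (\<phi>::int \<Rightarrow> real^'m).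
          \<exists>(x::nat \<Rightarrow> 'a \<Rightarrow> real^'n) (u::int \<Rightarrow> 'a \<Rightarrow> real^'m).
            (\<forall>\<omega>\<in>space M. x 0 \<omega> = \<xi>0) \<and>
            (\<forall>s\<in>{- int D..-1}. \<forall>\<omega>\<in>space M. u s \<omega> = \<phi> s) \<and>
            (\<forall>t. \<forall>\<omega>\<in>space M. x (Suc t) \<omega> = f t \<omega> (x t \<omega>) (\<lambda>s. u s \<omega>)) \<and>
            admissible_control M w0 wD D K0 K x u \<and>
            (\<lambda>t. mean_square M (x t)) \<longlonglongrightarrow> 0)"

definition delayed_stabilizable ::
  "'a measure \<Rightarrow> (nat \<Rightarrow> 'a \<Rightarrow> real) \<Rightarrow> (nat \<Rightarrow> 'a \<Rightarrow> real)
    \<Rightarrow> real^'n^'n \<Rightarrow> real^'m^'n \<Rightarrow> real^'m^'n \<Rightarrow> real^'m^'n \<Rightarrow> nat \<Rightarrow> bool" where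
  "delayed_stabilizable M w0 wD A C0 B C D \<longleftrightarrow>
     ms_stabilizable M w0 wD D (delayed_dynamics A C0 B C w0 wD D)"

definition delay_free_stabilizable ::
  "'a measure \<Rightarrow> (nat \<Rightarrow> 'a \<Rightarrow> real) \<Rightarrow> (nat \<Rightarrow> 'a \<Rightarrow> real)
    \<Rightarrow> real^'n^'n \<Rightarrow> real^'m^'n \<Rightarrow> bool" where
  "delay_free_stabilizable M w0 wD A C0 \<longleftrightarrow>
     ms_stabilizable M w0 wD 0 (delay_free_dynamics A C0 w0)"

end

theory Submission
  imports Defs
begin

text \<open>
All that has to be shown is that stabilizability at delay \<open>D + 1\<close> implies stabilizability at delay
\<open>D\<close>: the set of good delays is then an initial segment of the natural numbers that contains
\<open>0\<close>, and the margin is its last element, or \<open>\<infinity>\<close>.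

The delay is moved out of the control path by predicting. Let
\<open>y t = A^D x t + (\<Sum>j<D. A^j B u (t - 1 - j))\<close>, the conditional mean of \<open>x (t + D)\<close> given the noise
before time \<open>t\<close>. It satisfies
\<open>y (t + 1) = A y t + B u t + w0 t A^D C0 u t + wD t A^D C u (t - D)\<close>,
so \<open>B\<close> now acts at once and the delay is left only in the directions \<open>A^D C0\<close>, \<open>A^D C\<close> in which
the noise enters, and in the argument of the last term. The noise at time \<open>t\<close> is centred and
independent of \<open>x\<close>, \<open>u\<close> up to time \<open>t\<close>, so second moments add up without cross terms. In such a
recursion of nonnegative quantities a time shift of one term does not matter for decay. Hence
stabilizability at delay \<open>D\<close> is equivalent to a single matrix inequality in \<open>A\<close>, \<open>B\<close>, \<open>A^D C0\<close>,
\<open>A^D C\<close>, called a moment certificate below. It is read off from the summed second moments of \<open>y\<close>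
and \<open>u\<close> along stabilized trajectories (\<open>stabilizable_imp_moment_certificate\<close>); conversely, the
linear regression of \<open>u\<close> on \<open>y\<close> that it contains is a stabilizing gain
(\<open>moment_certificate_imp_stabilizable\<close>).

Monotonicity now comes from waiting (\<open>moment_certificate_of_propagated_noise\<close>). At delay \<open>D\<close> a
noise pulse enters as \<open>A^D C0 u\<close>; left alone for one step it becomes \<open>A^(D + 1) C0 u\<close>, which is the
pulse that the controller for delay \<open>D + 1\<close> can handle. Since the system is linear, each pulse may be
treated separately in this way. The resulting control is no longer a function of \<open>y\<close>, and this is
why the certificate speaks of joint second moments of \<open>y\<close> and \<open>u\<close> instead of a gain.
\<close>

section \<open>Matrix powers and quadratic forms\<close>

primrec mpow :: "real^'n^'n \<Rightarrow> nat \<Rightarrow> real^'n^'n" where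
  "mpow A 0 = mat 1"
| "mpow A (Suc k) = A ** mpow A k"

lemma mpow_commute: "A ** mpow A k = mpow A k ** A"
  by (induction k) (simp_all add: matrix_mul_assoc)

lemma invertible_mpow: "invertible A \<Longrightarrow> invertible (mpow A k)"
proof (induction k)
  case 0 show ?case by (simp add: invertible_def exI[of _ "mat 1"])
next
  case (Suc k) then show ?case by (simp add: invertible_mult)
qed

definition quad_form :: "real^'k^'k \<Rightarrow> real^'k \<Rightarrow> real" where
  "quad_form X a = a \<bullet> (X *v a)"

lemma quad_form_uminus [simp]: "quad_form X (- a) = quad_form X a"
  by (simp add: quad_form_def linear_neg)

lemma symmetric_inner:
  assumes "transpose X = (X :: real^'k^'k)"
  shows "a \<bullet> (X *v b) = b \<bullet> (X *v a)"
  by (metis assms dot_lmul_matrix inner_commute vector_transpose_matrix)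

lemma quad_form_add:
  assumes "transpose X = (X :: real^'k^'k)"
  shows "quad_form X (a + b) = quad_form X a + 2 * (a \<bullet> (X *v b)) + quad_form X b"
  using symmetric_inner[OF assms, of a b]
  by (simp add: quad_form_def matrix_vector_right_distrib inner_add_left inner_add_right)

lemma quad_form_plus_matrix: "quad_form (X + Y) a = quad_form X a + quad_form Y a"
  by (simp add: quad_form_def matrix_vector_mult_add_rdistrib inner_add_right)

lemma quad_form_scaleR_matrix: "quad_form (c *\<^sub>R X) a = c * quad_form X a"
  by (simp add: quad_form_def flip: scaleR_matrix_vector_assoc)

lemma transpose_plus: "transpose (X + Y) = transpose X + transpose (Y :: real^'k^'l)"
  by (simp add: transpose_def vec_eq_iff)

lemma quad_form_congruence: "quad_form (G ** U ** transpose G) a = quad_form U (a v* G)"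
  by (simp add: quad_form_def matrix_vector_mul_assoc[symmetric] dot_lmul_matrix)

lemma transpose_congruence:
  fixes U :: "real^'m^'m" and G :: "real^'m^'n"
  assumes "transpose U = U"
  shows "transpose (G ** U ** transpose G) = G ** U ** transpose G"
  by (simp add: matrix_transpose_mul assms matrix_mul_assoc)

lemma quad_form_bound: "\<exists>c>0. \<forall>a. quad_form X a \<le> c * (a \<bullet> a)"
proof -
  obtain B where B: "\<And>a. norm (X *v a) \<le> norm a * B" "B > 0"
    using bounded_linear.pos_bounded[OF matrix_vector_mul_bounded_linear[of X]] by blast
  have "quad_form X a \<le> B * (a \<bullet> a)" for a
  proof -
    have "quad_form X a \<le> norm a * norm (X *v a)"
      unfolding quad_form_def by (rule norm_cauchy_schwarz)
    also have "\<dots> \<le> norm a * (norm a * B)"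
      using B by (intro mult_left_mono) auto
    also have "\<dots> = B * (a \<bullet> a)" by (simp add: dot_square_norm power2_eq_square)
    finally show ?thesis .
  qed
  with B show ?thesis by blast
qed

lemma uminus_matrix_vector: "(- N) *v v = - (N *v v)" for N :: "real^'k^'l"
  by (simp add: vec_eq_iff matrix_vector_mult_def sum_negf)

lemma inner_sum_matrix:
  "b \<bullet> ((\<Sum>s\<in>S. G s) *v a) = (\<Sum>s\<in>S. b \<bullet> (G s *v a))" for G :: "'s \<Rightarrow> real^'k^'l"
  by (induction S rule: infinite_finite_induct)
    (simp_all add: matrix_vector_mult_add_rdistrib inner_add_right)

lemma transpose_sum: "transpose (\<Sum>s\<in>S. G s) = (\<Sum>s\<in>S. transpose (G s))"
  for G :: "'s \<Rightarrow> real^'k^'l"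
  by (simp add: transpose_def vec_eq_iff)

lemma vector_matrix_bound:
  fixes L :: "real^'m^'n"
  shows "\<exists>c>0. \<forall>a. (a v* L) \<bullet> (a v* L) \<le> c * (a \<bullet> a)"
proof -
  have "(a v* L) \<bullet> (a v* L) = quad_form (L ** transpose L) a" for a
    by (simp add: quad_form_def dot_lmul_matrix flip: matrix_vector_mul_assoc)
  then show ?thesis using quad_form_bound[of "L ** transpose L"] by simp
qed

section \<open>The moment certificate\<close>

text \<open>
When \<open>X\<close>, \<open>F\<close>, \<open>U\<close> are the moments \<open>E y y'\<close>, \<open>E u y'\<close>, \<open>E u u'\<close>, this is the mean square of
\<open>a \<bullet> y + b \<bullet> u\<close>.
\<close>

definition joint_form :: "real^'n^'n \<Rightarrow> real^'n^'m \<Rightarrow> real^'m^'m \<Rightarrow> real^'n \<Rightarrow> real^'m \<Rightarrow> real" where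
  "joint_form X F U a b = quad_form X a + 2 * (b \<bullet> (F *v a)) + quad_form U b"

text \<open>
For the recursion \<open>y (t + 1) = A y t + B u t + w0 t G u t + wD t H u t\<close> with noise variances
\<open>s0\<close>, \<open>sD\<close>, let \<open>X\<close>, \<open>F\<close>, \<open>U\<close> be the sums, over time and over enough initial states, of \<open>E y y'\<close>, \<open>E u y'\<close>, \<open>E u u'\<close>.
Summing the second moment of \<open>a \<bullet> y (t + 1)\<close> gives the inequality, where the term with
\<open>\<epsilon>\<close> is a lower bound for the initial second moment, which is lost by the shift in time.
\<close>

definition moment_certificate ::
  "real^'n^'n \<Rightarrow> real^'m^'n \<Rightarrow> real^'m^'n \<Rightarrow> real^'m^'n \<Rightarrow> real \<Rightarrow> real \<Rightarrow> bool" where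
  "moment_certificate A B G H s0 sD \<longleftrightarrow>
     (\<exists>X F U \<epsilon>. \<epsilon> > 0 \<and> transpose X = X \<and> transpose U = U \<and>
        (\<forall>a b. 0 \<le> joint_form X F U a b) \<and>
        (\<forall>a. joint_form X F U (a v* A) (a v* B) + s0 * quad_form U (a v* G) + sD * quad_form U (a v* H)
               + \<epsilon> * (a \<bullet> a) \<le> quad_form X a))"

text \<open>
The waiting argument. With noise directions \<open>G\<close>, \<open>H\<close>, split the state into the part on which the
given controller acts and the pulse \<open>w0 G u + wD H u\<close> of the last step, which is left alone for one
step and reaches the active part as \<open>w0 (A G) u + wD (A H) u\<close>. The two parts are uncorrelated, so the
second moment of the whole state is \<open>X + R\<close>, where \<open>R\<close> is that of the waiting pulse. The waiting
pulse is also uncorrelated with the control, so \<open>F\<close> and \<open>U\<close> stay the same.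
\<close>

lemma moment_certificate_of_propagated_noise:
  fixes A :: "real^'n^'n" and B G H :: "real^'m^'n"
  assumes cert: "moment_certificate A B (A ** G) (A ** H) s0 sD" and s: "s0 \<ge> 0" "sD \<ge> 0"
  shows "moment_certificate A B G H s0 sD"
proof -
  from cert obtain X F U \<epsilon> where e: "\<epsilon> > 0" and X: "transpose X = X" and U: "transpose U = U"
    and pos: "\<And>a b. 0 \<le> joint_form X F U a b"
    and ineq: "\<And>a. joint_form X F U (a v* A) (a v* B) + s0 * quad_form U (a v* (A ** G))
       + sD * quad_form U (a v* (A ** H)) + \<epsilon> * (a \<bullet> a) \<le> quad_form X a"
    unfolding moment_certificate_def by blast
  define R where "R = s0 *\<^sub>R (G ** U ** transpose G) + sD *\<^sub>R (H ** U ** transpose H)"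
  have R: "transpose R = R"
    unfolding R_def
    by (simp add: transpose_plus transpose_scalar transpose_congruence[OF U])
  have qfR: "quad_form R a = s0 * quad_form U (a v* G) + sD * quad_form U (a v* H)" for a
    by (simp only: R_def quad_form_plus_matrix quad_form_scaleR_matrix quad_form_congruence)
  have qfX: "quad_form (X + R) a = quad_form X a + quad_form R a" for a
    by (rule quad_form_plus_matrix)
  have Upos: "0 \<le> quad_form U b" for b
    using pos[of 0 b] by (simp add: joint_form_def quad_form_def)
  show ?thesis
    unfolding moment_certificate_def
  proof (intro exI conjI allI)
    show "0 < \<epsilon>" by fact
    show "transpose (X + R) = X + R"
      by (simp add: transpose_plus X R)
    show "transpose U = U" by fact
  next
    fix a b show "0 \<le> joint_form (X + R) F U a b"
      using pos[of a b] mult_nonneg_nonneg[OF s(1) Upos[of "a v* G"]]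
        mult_nonneg_nonneg[OF s(2) Upos[of "a v* H"]] by (simp add: joint_form_def qfX qfR)
  next
    fix a
    show "joint_form (X + R) F U (a v* A) (a v* B) + s0 * quad_form U (a v* G) + sD * quad_form U (a v* H)
        + \<epsilon> * (a \<bullet> a) \<le> quad_form (X + R) a"
      using ineq[of a] by (simp add: joint_form_def qfX qfR vector_matrix_mul_assoc)
  qed
qed

text \<open>
The gain \<open>K = F X^(-1)\<close> makes \<open>K y\<close> the linear regression of \<open>u\<close> on \<open>y\<close>. Replacing \<open>u\<close> by \<open>K y\<close>
removes a residual that is uncorrelated with \<open>y\<close>, which can only decrease the second moments on the
left of the inequality. In matrix terms this is nonnegativity of the Schur complement
\<open>U - F X^(-1) F'\<close>.
\<close>

lemma moment_certificate_imp_gain: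
  fixes A :: "real^'n^'n" and B G H :: "real^'m^'n"
  assumes cert: "moment_certificate A B G H s0 sD" and s: "s0 \<ge> 0" "sD \<ge> 0"
  shows "\<exists>X K \<epsilon>. \<epsilon> > 0 \<and> (\<forall>a.
     quad_form X (a v* (A + B ** K)) + s0 * quad_form X (a v* (G ** K)) + sD * quad_form X (a v* (H ** K)) + \<epsilon> * (a \<bullet> a)
       \<le> quad_form X a) \<and> (\<forall>a. \<epsilon> * (a \<bullet> a) \<le> quad_form X a)"
proof -
  from cert obtain X F U \<epsilon> where e: "\<epsilon> > 0" and X: "transpose X = X" and U: "transpose U = U"
    and pos: "\<And>a b. 0 \<le> joint_form X F U a b"
    and ineq: "\<And>a. joint_form X F U (a v* A) (a v* B) + s0 * quad_form U (a v* G)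
       + sD * quad_form U (a v* H) + \<epsilon> * (a \<bullet> a) \<le> quad_form X a"
    unfolding moment_certificate_def by blast
  have Upos: "0 \<le> quad_form U b" for b
    using pos[of 0 b] by (simp add: joint_form_def quad_form_def)
  have Xpos: "\<epsilon> * (a \<bullet> a) \<le> quad_form X a" for a
    using ineq[of a] pos[of "a v* A" "a v* B"] mult_nonneg_nonneg[OF s(1) Upos[of "a v* G"]]
      mult_nonneg_nonneg[OF s(2) Upos[of "a v* H"]] by linarith
  have "a = 0" if "X *v a = 0" for a
  proof -
    have "\<epsilon> * (a \<bullet> a) \<le> 0" using Xpos[of a] that by (simp add: quad_form_def)
    with e have "a \<bullet> a \<le> 0" by (simp add: mult_le_0_iff)
    then show ?thesis by (metis inner_eq_zero_iff inner_ge_zero order_antisym)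
  qed
  then obtain Xi where inv: "Xi ** X = mat 1"
    using matrix_left_invertible_ker by blast
  define K where "K = F ** Xi"
  have XK: "X *v (b v* K) = b v* F" for b
  proof -
    have "X *v (b v* K) = (b v* K) v* X" by (metis X vector_transpose_matrix)
    also have "\<dots> = b v* (F ** (Xi ** X))"
      by (simp add: K_def vector_matrix_mul_assoc matrix_mul_assoc)
    finally show ?thesis by (simp add: inv)
  qed
  have qfK: "quad_form X (b v* K) = b \<bullet> (F *v (b v* K))" for b
    by (simp add: quad_form_def XK dot_lmul_matrix inner_commute)
  \<comment> \<open>Nonnegativity of the joint form at the regression coefficient is the Schur complement inequality.\<close>
  have le_U: "quad_form X (b v* K) \<le> quad_form U b" for b
    using pos[of "- (b v* K)" b] by (simp add: joint_form_def qfK linear_neg)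
  have le_joint: "quad_form X (a + b v* K) \<le> joint_form X F U a b" for a b
    using le_U[of b] dot_lmul_matrix[of b F a] inner_commute[of a "b v* F"]
    by (simp add: quad_form_add[OF X] XK joint_form_def)
  have "quad_form X (a v* (A + B ** K)) + s0 * quad_form X (a v* (G ** K)) + sD * quad_form X (a v* (H ** K)) + \<epsilon> * (a \<bullet> a)
       \<le> quad_form X a" for a
  proof -
    have "quad_form X (a v* (A + B ** K)) \<le> joint_form X F U (a v* A) (a v* B)"
      using le_joint[of "a v* A" "a v* B"]
      by (simp add: vector_matrix_mult_add_rdistrib vector_matrix_mul_assoc)
    moreover have "quad_form X (a v* (G ** K)) \<le> quad_form U (a v* G)" "quad_form X (a v* (H ** K)) \<le> quad_form U (a v* H)"
      using le_U[of "a v* G"] le_U[of "a v* H"] by (simp_all add: vector_matrix_mul_assoc)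
    ultimately show ?thesis
      using ineq[of a] s by (smt (verit) mult_left_mono)
  qed
  with e Xpos show ?thesis by blast
qed

section \<open>Independence of the noise\<close>

context noise_channels
begin

text \<open>
Both channels as one family with labels in \<open>nat + nat\<close>, so that any two disjoint sets of labels carry
independent information. The noise \<open>w0 t\<close> has to be independent of the past, and \<open>wD t\<close> of the
past together with \<open>w0 t\<close>.
\<close>

definition noise :: "nat + nat \<Rightarrow> 'a \<Rightarrow> real" where
  "noise = case_sum w0 wD"

lemma noise_simps [simp]: "noise (Inl t) = w0 t" "noise (Inr t) = wD t"
  by (simp_all add: noise_def)

definition noise_var :: "nat + nat \<Rightarrow> real" where
  "noise_var = case_sum (\<lambda>_. \<sigma>0\<^sup>2) (\<lambda>_. \<sigma>D\<^sup>2)"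

definition events_of :: "nat + nat \<Rightarrow> 'a set set" where
  "events_of i = {noise i -` S \<inter> space M |S. S \<in> sets borel}"

definition info :: "(nat + nat) set \<Rightarrow> 'a measure" where
  "info I = sigma (space M) (\<Union>i\<in>I. events_of i)"

lemma measurable_w0: "w0 t \<in> borel_measurable M"
  using indep_w0 by (simp add: indep_vars_def2)

lemma measurable_wD: "wD t \<in> borel_measurable M"
  using indep_wD by (simp add: indep_vars_def2)

lemma measurable_noise: "noise i \<in> borel_measurable M"
  by (cases i) (auto simp: measurable_w0 measurable_wD)

lemma events_of_subset: "events_of i \<subseteq> events"
  using measurable_noise[of i] by (auto simp: events_of_def)

lemma Int_stable_events_of: "Int_stable (events_of i)"
proof (rule Int_stableI)
  fix a b assume "a \<in> events_of i" "b \<in> events_of i"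
  then obtain S T where "S \<in> sets borel" "a = noise i -` S \<inter> space M"
     "T \<in> sets borel" "b = noise i -` T \<inter> space M"
    by (auto simp: events_of_def)
  then have "a \<inter> b = noise i -` (S \<inter> T) \<inter> space M" "S \<inter> T \<in> sets borel" by auto
  then show "a \<inter> b \<in> events_of i" unfolding events_of_def by blast
qed

lemma path_event:
  assumes "finite J" and S: "\<And>t. t \<in> J \<Longrightarrow> S t \<in> sets borel"
  shows "{f :: nat \<Rightarrow> real. \<forall>t\<in>J. f t \<in> S t} \<in> sets (\<Pi>\<^sub>M t\<in>UNIV. borel)"
proof -
  have "{f \<in> space (\<Pi>\<^sub>M t\<in>UNIV. borel). f t \<in> S t} \<in> sets (\<Pi>\<^sub>M t\<in>UNIV. (borel :: real measure))"
    if "t \<in> J" for t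
    using measurable_sets[OF measurable_component_singleton[of t UNIV "\<lambda>_. borel"] S[OF that]]
    by (simp add: vimage_def Int_def conj_commute)
  then have "{f \<in> space (\<Pi>\<^sub>M t\<in>UNIV. borel). \<forall>t\<in>J. f t \<in> S t}
      \<in> sets (\<Pi>\<^sub>M t\<in>UNIV. (borel :: real measure))"
    using assms(1) by (intro sets.sets_Collect_finite_All)
  then show ?thesis by (simp add: space_PiM)
qed

lemma prob_path_event:
  assumes X: "indep_vars (\<lambda>_. borel) X UNIV"
    and "finite J" and S: "\<And>t. t \<in> J \<Longrightarrow> S t \<in> sets borel"
  shows "prob ((\<lambda>\<omega> t. X t \<omega>) -` {f :: nat \<Rightarrow> real. \<forall>t\<in>J. f t \<in> S t} \<inter> space M)
    = (\<Prod>t\<in>J. prob (X t -` S t \<inter> space M))"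
proof (cases "J = {}")
  case True then show ?thesis by (simp add: prob_space)
next
  case False
  have "(\<lambda>\<omega> t. X t \<omega>) -` {f. \<forall>t\<in>J. f t \<in> S t} \<inter> space M = (\<Inter>t\<in>J. X t -` S t \<inter> space M)"
    using False by auto
  then show ?thesis
    using indep_varsD[OF X False assms(2) subset_UNIV S] by simp
qed

text \<open>
The events of a finite set of labels split into an event of the path of \<open>w0\<close> and one of the path of
\<open>wD\<close>. The two paths are independent, and within each channel the times are.
\<close>

lemma indep_events_of: "indep_sets events_of UNIV"
proof (rule indep_setsI)
  show "events_of i \<subseteq> events" for i by (rule events_of_subset)
next
  fix E J assume J: "J \<noteq> {}" "J \<subseteq> UNIV" "finite (J :: (nat + nat) set)" and E: "\<forall>j\<in>J. E j \<in> events_of j"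
  then have "\<forall>j\<in>J. \<exists>S. S \<in> sets borel \<and> E j = noise j -` S \<inter> space M"
    by (auto simp: events_of_def)
  then obtain S where S: "\<And>j. j \<in> J \<Longrightarrow> S j \<in> sets borel"
    and ES: "\<And>j. j \<in> J \<Longrightarrow> E j = noise j -` S j \<inter> space M"
    by metis
  define J0 where "J0 = {t. Inl t \<in> J}"
  define JD where "JD = {t. Inr t \<in> J}"
  have J_eq: "J = Inl ` J0 \<union> Inr ` JD"
  proof (intro set_eqI)
    fix j show "j \<in> J \<longleftrightarrow> j \<in> Inl ` J0 \<union> Inr ` JD" by (cases j) (auto simp: J0_def JD_def)
  qed
  have fin: "finite J0" "finite JD"
    using \<open>finite J\<close> unfolding J_eq by (auto simp: finite_image_iff)
  define X0 where "X0 = {f :: nat \<Rightarrow> real. \<forall>t\<in>J0. f t \<in> S (Inl t)}"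
  define XD where "XD = {f :: nat \<Rightarrow> real. \<forall>t\<in>JD. f t \<in> S (Inr t)}"
  have sets: "X0 \<in> sets (\<Pi>\<^sub>M t\<in>UNIV. borel)" "XD \<in> sets (\<Pi>\<^sub>M t\<in>UNIV. borel)"
    unfolding X0_def XD_def using fin S by (intro path_event; simp add: J0_def JD_def)+
  have "(\<Inter>j\<in>J. E j) = (\<lambda>\<omega>. (\<lambda>t. w0 t \<omega>, \<lambda>t. wD t \<omega>)) -` (X0 \<times> XD) \<inter> space M"
  proof -
    have "(\<Inter>j\<in>J. E j) = {\<omega> \<in> space M. \<forall>j\<in>J. noise j \<omega> \<in> S j}"
      using J(1) ES by auto
    then show ?thesis by (auto simp: J_eq X0_def XD_def ball_Un)
  qed
  then have "prob (\<Inter>j\<in>J. E j)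
    = prob ((\<lambda>\<omega> t. w0 t \<omega>) -` X0 \<inter> space M) * prob ((\<lambda>\<omega> t. wD t \<omega>) -` XD \<inter> space M)"
    using indep_varD[OF indep_w0_wD sets] by simp
  also have "\<dots> = (\<Prod>t\<in>J0. prob (w0 t -` S (Inl t) \<inter> space M))
      * (\<Prod>t\<in>JD. prob (wD t -` S (Inr t) \<inter> space M))"
    unfolding X0_def XD_def
    by (intro arg_cong2[where f = "(*)"] prob_path_event indep_w0 indep_wD fin)
      (use S in \<open>auto simp: J0_def JD_def\<close>)
  also have "\<dots> = (\<Prod>t\<in>J0. prob (E (Inl t))) * (\<Prod>t\<in>JD. prob (E (Inr t)))"
    by (intro arg_cong2[where f = "(*)"] prod.cong)
      (auto simp: ES J0_def JD_def)
  also have "\<dots> = (\<Prod>j\<in>J. prob (E j))"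
  proof -
    have "(\<Prod>j\<in>J. prob (E j)) = (\<Prod>j\<in>Inl ` J0. prob (E j)) * (\<Prod>j\<in>Inr ` JD. prob (E j))"
      unfolding J_eq using fin by (intro prod.union_disjoint) auto
    then show ?thesis by (simp add: prod.reindex)
  qed
  finally show "prob (\<Inter>j\<in>J. E j) = (\<Prod>j\<in>J. prob (E j))" .
qed

lemma space_info [simp]: "space (info I) = space M"
  using events_of_subset sets.sets_into_space by (auto simp: info_def space_measure_of_conv)

lemma sets_info: "sets (info I) = sigma_sets (space M) (\<Union>i\<in>I. events_of i)"
  unfolding info_def
  using events_of_subset sets.sets_into_space by (intro sets_measure_of) blast

lemma sets_info_mono: "I \<subseteq> J \<Longrightarrow> sets (info I) \<subseteq> sets (info J)"
  unfolding sets_info by (intro sigma_sets_mono') auto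

lemma sets_info_subset: "sets (info I) \<subseteq> events"
  unfolding sets_info using events_of_subset by (intro sets.sigma_sets_subset) blast

lemma measurable_info_mono:
  "f \<in> measurable (info I) N \<Longrightarrow> I \<subseteq> J \<Longrightarrow> f \<in> measurable (info J) N"
  using sets_info_mono[of I J] by (auto simp: measurable_def)

lemma measurable_info_imp: "f \<in> measurable (info I) N \<Longrightarrow> f \<in> measurable M N"
  using sets_info_subset[of I] by (auto simp: measurable_def)

lemma noise_measurable_info: "i \<in> I \<Longrightarrow> noise i \<in> borel_measurable (info I)"
  by (auto simp: measurable_def sets_info events_of_def intro!: sigma_sets.Basic)

text \<open>
Independence of generating families closed under intersection passes to the generated
\<open>\<sigma>\<close>-algebras when the labels are grouped into disjoint blocks.
\<close>

lemma indep_var_info: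
  assumes f: "f \<in> borel_measurable (info I)" and g: "g \<in> borel_measurable (info J)"
    and "I \<inter> J = {}"
  shows "indep_var borel (f :: 'a \<Rightarrow> real) borel (g :: 'a \<Rightarrow> real)"
proof -
  define L where "L = case_bool I J"
  have "indep_sets (\<lambda>b. sigma_sets (space M) (\<Union>i\<in>L b. events_of i)) UNIV"
    using \<open>I \<inter> J = {}\<close> Int_stable_events_of
    by (intro indep_sets_collect_sigma)
      (auto simp: disjoint_family_on_def L_def split: bool.splits
        intro: indep_sets_mono_index[OF _ indep_events_of])
  then have "indep_sets (\<lambda>b. sets (info (L b))) UNIV" by (simp add: sets_info)
  then have ind: "indep_set (sets (info I)) (sets (info J))"
    unfolding indep_set_def L_def
    by (rule indep_sets_cong[THEN iffD1, rotated 2]) (auto split: bool.splits)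
  have sub: "sigma_sets (space M) {h -` S \<inter> space M |S. S \<in> sets borel} \<subseteq> sets (info K)"
    if "h \<in> borel_measurable (info K)" for h :: "'a \<Rightarrow> real" and K
  proof -
    have "{h -` S \<inter> space M |S. S \<in> sets borel} \<subseteq> sets (info K)"
      using measurable_sets[OF that] by auto
    from sets.sigma_sets_subset[OF this] show ?thesis by simp
  qed
  show ?thesis
    unfolding indep_var_eq
  proof (intro conjI)
    show "f \<in> borel_measurable M" "g \<in> borel_measurable M"
      using f g by (auto intro: measurable_info_imp)
    show "indep_set (sigma_sets (space M) {f -` S \<inter> space M |S. S \<in> sets borel})
      (sigma_sets (space M) {g -` S \<inter> space M |S. S \<in> sets borel})"
      using ind sub[OF f] sub[OF g] unfolding indep_sets2_eq by (meson subset_eq)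
  qed
qed

section \<open>Second moments of adapted random vectors\<close>

definition L2 :: "(nat + nat) set \<Rightarrow> ('a \<Rightarrow> real) \<Rightarrow> bool" where
  "L2 I f \<longleftrightarrow> f \<in> borel_measurable (info I) \<and> integrable M (\<lambda>\<omega>. (f \<omega>)\<^sup>2)"

lemma L2_measurable: "L2 I f \<Longrightarrow> f \<in> borel_measurable M"
  by (auto simp: L2_def dest: measurable_info_imp)

lemma L2_mono: "L2 I f \<Longrightarrow> I \<subseteq> J \<Longrightarrow> L2 J f"
  by (auto simp: L2_def intro: measurable_info_mono)

lemma L2_const [simp]: "L2 I (\<lambda>_. c)"
  by (simp add: L2_def)

lemma L2_integrable_mult:
  assumes "L2 I f" "L2 J g" 
  shows "integrable M (\<lambda>\<omega>. f \<omega> * g \<omega>)"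
proof (rule Bochner_Integration.integrable_bound)
  show "integrable M (\<lambda>\<omega>. (f \<omega>)\<^sup>2 + (g \<omega>)\<^sup>2)"
    using assms by (auto simp: L2_def)
  show "(\<lambda>\<omega>. f \<omega> * g \<omega>) \<in> borel_measurable M"
    using assms[THEN L2_measurable] by simp
  have "\<bar>x * y\<bar> \<le> \<bar>x\<^sup>2 + y\<^sup>2\<bar>" for x y :: real
  proof -
    have "2 * (x * y) \<le> x\<^sup>2 + y\<^sup>2" "- (2 * (x * y)) \<le> x\<^sup>2 + y\<^sup>2"
      using sum_squares_bound[of x y] sum_squares_bound[of x "-y"] by (simp_all add: mult.assoc)
    then show ?thesis by linarith
  qed
  then show "AE \<omega> in M. norm (f \<omega> * g \<omega>) \<le> norm ((f \<omega>)\<^sup>2 + (g \<omega>)\<^sup>2)" by simp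
qed

lemma L2_add:
  assumes "L2 I f" "L2 I g" shows "L2 I (\<lambda>\<omega>. f \<omega> + g \<omega>)"
  using assms L2_integrable_mult[OF assms]
  by (auto simp: L2_def power2_sum mult.assoc)

lemma L2_sum:
  assumes "\<And>s. s \<in> S \<Longrightarrow> L2 I (f s)" shows "L2 I (\<lambda>\<omega>. \<Sum>s\<in>S. f s \<omega>)"
  using assms by (induction S rule: infinite_finite_induct) (auto intro: L2_add)

lemma expectation_noise [simp]: "expectation (noise i) = 0"
  by (cases i) (auto simp: mean_w0 mean_wD)

lemma expectation_noise_sq: "expectation (\<lambda>\<omega>. (noise i \<omega>)\<^sup>2) = noise_var i"
  using cov_w0 cov_wD
  by (cases i) (auto simp: noise_var_def power2_eq_square)

lemma L2_noise: "i \<in> I \<Longrightarrow> L2 I (noise i)"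
  using square_integrable_w0 square_integrable_wD noise_measurable_info[of i I]
  by (cases i) (simp_all add: L2_def)

lemma noise_mult:
  assumes f: "L2 I f" and i: "i \<notin> I"
  shows L2_noise_mult: "L2 (insert i I) (\<lambda>\<omega>. noise i \<omega> * f \<omega>)"
    and expectation_noise_mult_sq:
      "expectation (\<lambda>\<omega>. (noise i \<omega> * f \<omega>)\<^sup>2) = noise_var i * expectation (\<lambda>\<omega>. (f \<omega>)\<^sup>2)"
proof -
  have n: "L2 {i} (noise i)" by (rule L2_noise) simp
  have iv: "indep_var borel (\<lambda>\<omega>. (noise i \<omega>)\<^sup>2) borel (\<lambda>\<omega>. (f \<omega>)\<^sup>2)"
    using n f i by (intro indep_var_info[of _ "{i}" _ I]) (auto simp: L2_def)
  have int: "integrable M (\<lambda>\<omega>. (noise i \<omega>)\<^sup>2)" "integrable M (\<lambda>\<omega>. (f \<omega>)\<^sup>2)"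
    using n f by (auto simp: L2_def)
  show "L2 (insert i I) (\<lambda>\<omega>. noise i \<omega> * f \<omega>)"
    using indep_var_integrable[OF iv int] L2_mono[OF f subset_insertI[of I i]]
      L2_noise[of i "insert i I"]
    by (auto simp: L2_def power_mult_distrib)
  show "expectation (\<lambda>\<omega>. (noise i \<omega> * f \<omega>)\<^sup>2) = noise_var i * expectation (\<lambda>\<omega>. (f \<omega>)\<^sup>2)"
    using indep_var_lebesgue_integral[OF iv int]
    by (simp add: power_mult_distrib expectation_noise_sq)
qed

lemma fresh_noise_uncorrelated:
  assumes f: "L2 I f" and g: "L2 I g" and i: "i \<notin> I"
  shows "expectation (\<lambda>\<omega>. g \<omega> * (noise i \<omega> * f \<omega>)) = 0"
proof -
  have n: "L2 {i} (noise i)" by (rule L2_noise) simp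
  have iv: "indep_var borel (noise i) borel (\<lambda>\<omega>. f \<omega> * g \<omega>)"
    using n f g i by (intro indep_var_info[of _ "{i}" _ I]) (auto simp: L2_def)
  have "integrable M (noise i)"
    using L2_integrable_mult[OF n L2_const[of _ 1]] by simp
  from indep_var_lebesgue_integral[OF iv this L2_integrable_mult[OF f g]]
  show ?thesis by (simp add: mult_ac)
qed

text \<open>
Centred noise that is independent of the information carried by \<open>f\<close> and \<open>g\<close> produces no cross
term.
\<close>

lemma fresh_noise_second_moment:
  assumes f: "L2 I f" and g: "L2 I g" and i: "i \<notin> I"
  shows "expectation (\<lambda>\<omega>. (g \<omega> + noise i \<omega> * f \<omega>)\<^sup>2)
    = expectation (\<lambda>\<omega>. (g \<omega>)\<^sup>2) + noise_var i * expectation (\<lambda>\<omega>. (f \<omega>)\<^sup>2)"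
proof -
  note nf = L2_noise_mult[OF f i]
  have "expectation (\<lambda>\<omega>. (g \<omega> + noise i \<omega> * f \<omega>)\<^sup>2)
    = expectation (\<lambda>\<omega>. (g \<omega>)\<^sup>2 + (noise i \<omega> * f \<omega>)\<^sup>2 + 2 * (g \<omega> * (noise i \<omega> * f \<omega>)))"
    by (simp add: power2_sum mult.assoc)
  also have "\<dots> = expectation (\<lambda>\<omega>. (g \<omega>)\<^sup>2) + expectation (\<lambda>\<omega>. (noise i \<omega> * f \<omega>)\<^sup>2)
      + 2 * expectation (\<lambda>\<omega>. g \<omega> * (noise i \<omega> * f \<omega>))"
    using g nf L2_integrable_mult[OF g nf]
    by (simp add: L2_def)
  finally show ?thesis
    by (simp add: fresh_noise_uncorrelated[OF f g i] expectation_noise_mult_sq[OF f i])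
qed

lemma L2_cong: "(\<And>\<omega>. \<omega> \<in> space M \<Longrightarrow> f \<omega> = g \<omega>) \<Longrightarrow> L2 I f \<longleftrightarrow> L2 I g"
  unfolding L2_def by (intro conj_cong measurable_cong Bochner_Integration.integrable_cong) auto

definition L2_vec :: "(nat + nat) set \<Rightarrow> ('a \<Rightarrow> real^'k) \<Rightarrow> bool" where
  "L2_vec I Z \<longleftrightarrow> (\<forall>a. L2 I (\<lambda>\<omega>. a \<bullet> Z \<omega>))"

text \<open>
The quadratic form of the matrix \<open>E Z Z'\<close>. Testing against fixed vectors turns linear images of \<open>Z\<close>
into a change of the test vector, and keeps all moment estimates scalar.
\<close>

definition second_moment :: "('a \<Rightarrow> real^'k) \<Rightarrow> real^'k \<Rightarrow> real" where
  "second_moment Z a = expectation (\<lambda>\<omega>. (a \<bullet> Z \<omega>)\<^sup>2)"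

text \<open>
The real-valued counterpart of \<open>mean_square\<close>; the two agree on square-integrable vectors.
\<close>

definition norm_sq_mean :: "('a \<Rightarrow> real^'k) \<Rightarrow> real" where
  "norm_sq_mean Z = expectation (\<lambda>\<omega>. Z \<omega> \<bullet> Z \<omega>)"

lemma L2_vec_inner: "L2_vec I Z \<Longrightarrow> L2 I (\<lambda>\<omega>. a \<bullet> Z \<omega>)"
  by (simp add: L2_vec_def)

lemma L2_vec_cong:
  assumes "\<And>\<omega>. \<omega> \<in> space M \<Longrightarrow> Y \<omega> = Z \<omega>" shows "L2_vec I Y \<longleftrightarrow> L2_vec I Z"
  unfolding L2_vec_def using assms by (intro all_cong1 L2_cong) auto

lemma second_moment_cong:
  assumes "\<And>\<omega>. \<omega> \<in> space M \<Longrightarrow> Y \<omega> = Z \<omega>" shows "second_moment Y a = second_moment Z a"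
  unfolding second_moment_def using assms by (intro Bochner_Integration.integral_cong) auto

lemma L2_vec_measurable:
  assumes "L2_vec I Z" shows "Z \<in> borel_measurable (info I)"
  using assms by (subst borel_measurable_euclidean_space) (simp add: L2_vec_def L2_def inner_commute)

lemma L2_vec_mono: "L2_vec I Z \<Longrightarrow> I \<subseteq> J \<Longrightarrow> L2_vec J Z"
  by (auto simp: L2_vec_def intro: L2_mono)

lemma L2_vec_const [simp]: "L2_vec I (\<lambda>_. c)"
  by (simp add: L2_vec_def)

lemma L2_vec_add: "L2_vec I Y \<Longrightarrow> L2_vec I Z \<Longrightarrow> L2_vec I (\<lambda>\<omega>. Y \<omega> + Z \<omega>)"
  by (simp add: L2_vec_def inner_add_right L2_add)

lemma L2_vec_sum: "(\<And>s. s \<in> S \<Longrightarrow> L2_vec I (Z s)) \<Longrightarrow> L2_vec I (\<lambda>\<omega>. \<Sum>s\<in>S. Z s \<omega>)"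
  by (simp add: L2_vec_def inner_sum_right L2_sum)

lemma L2_vec_matrix: "L2_vec I Z \<Longrightarrow> L2_vec I (\<lambda>\<omega>. G *v Z \<omega>)"
  by (simp add: L2_vec_def flip: dot_lmul_matrix)

lemma L2_vec_noise: "L2_vec I Z \<Longrightarrow> i \<notin> I \<Longrightarrow> L2_vec (insert i I) (\<lambda>\<omega>. noise i \<omega> *\<^sub>R Z \<omega>)"
  by (simp add: L2_vec_def L2_noise_mult)

lemma second_moment_nonneg [simp]: "0 \<le> second_moment Z a"
  by (simp add: second_moment_def)

lemma second_moment_matrix: "second_moment (\<lambda>\<omega>. G *v Z \<omega>) a = second_moment Z (a v* G)"
  by (simp add: second_moment_def flip: dot_lmul_matrix)

text \<open>
Two successive applications of the scalar case: \<open>noise j\<close> is still fresh after \<open>noise i\<close> has been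
added to the available information.
\<close>

lemma second_moment_noise_step:
  assumes Y: "L2_vec I Y" and Z: "L2_vec I Z" and W: "L2_vec I W"
    and "i \<notin> I" "j \<notin> I" "i \<noteq> j"
  shows "second_moment (\<lambda>\<omega>. Y \<omega> + noise i \<omega> *\<^sub>R Z \<omega> + noise j \<omega> *\<^sub>R W \<omega>) a
    = second_moment Y a + noise_var i * second_moment Z a + noise_var j * second_moment W a"
proof -
  let ?I = "insert i I"
  have 1: "L2 ?I (\<lambda>\<omega>. a \<bullet> Y \<omega> + noise i \<omega> * (a \<bullet> Z \<omega>))"
    using assms by (intro L2_add L2_noise_mult L2_mono[of I _ ?I] L2_vec_inner) auto
  have 2: "L2 ?I (\<lambda>\<omega>. a \<bullet> W \<omega>)"
    using W by (intro L2_mono[of I _ ?I] L2_vec_inner) auto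
  have "j \<notin> ?I" using assms by auto
  from fresh_noise_second_moment[OF 2 1 this]
    fresh_noise_second_moment[OF L2_vec_inner[OF Z] L2_vec_inner[OF Y] \<open>i \<notin> I\<close>, of a a]
  show ?thesis by (simp add: second_moment_def inner_add_right)
qed

lemma L2_vec_noise_step:
  assumes Y: "L2_vec I Y" and Z: "L2_vec I Z" and W: "L2_vec I W"
    and "i \<notin> I" "j \<notin> I"
  shows "L2_vec (insert j (insert i I)) (\<lambda>\<omega>. Y \<omega> + noise i \<omega> *\<^sub>R Z \<omega> + noise j \<omega> *\<^sub>R W \<omega>)"
  using L2_vec_mono[OF Y, of "insert j (insert i I)"]
    L2_vec_mono[OF L2_vec_noise[OF Z \<open>i \<notin> I\<close>], of "insert j (insert i I)"]
    L2_vec_mono[OF L2_vec_noise[OF W \<open>j \<notin> I\<close>], of "insert j (insert i I)"]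
  by (auto intro!: L2_vec_add)

lemma L2_vec_integrable_inner_sq: "L2_vec I Z \<Longrightarrow> integrable M (\<lambda>\<omega>. (a \<bullet> Z \<omega>)\<^sup>2)"
  by (simp add: L2_vec_def L2_def)

lemma inner_self_axis: "z \<bullet> z = (\<Sum>i\<in>UNIV. (axis i 1 \<bullet> z)\<^sup>2)" for z :: "real^'k"
  by (simp add: inner_vec_def[of z z] inner_axis' power2_eq_square)

lemma L2_vec_integrable_norm_sq: "L2_vec I Z \<Longrightarrow> integrable M (\<lambda>\<omega>. Z \<omega> \<bullet> Z \<omega>)"
  unfolding inner_self_axis by (intro Bochner_Integration.integrable_sum L2_vec_integrable_inner_sq)

lemma norm_sq_mean_eq_sum: "L2_vec I Z \<Longrightarrow> norm_sq_mean Z = (\<Sum>i\<in>UNIV. second_moment Z (axis i 1))"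
  unfolding norm_sq_mean_def second_moment_def inner_self_axis
  by (intro Bochner_Integration.integral_sum L2_vec_integrable_inner_sq)

lemma norm_sq_mean_nonneg [simp]: "0 \<le> norm_sq_mean Z"
  by (simp add: norm_sq_mean_def)

lemma mean_square_eq_norm_sq_mean: "L2_vec I Z \<Longrightarrow> mean_square M Z = ennreal (norm_sq_mean Z)"
  unfolding mean_square_def norm_sq_mean_def
  by (intro nn_integral_eq_integral L2_vec_integrable_norm_sq) auto

lemma second_moment_le_norm_sq_mean: 
  assumes "L2_vec I Z" shows "second_moment Z a \<le> norm_sq_mean Z * (a \<bullet> a)"
proof -
  have "second_moment Z a \<le> expectation (\<lambda>\<omega>. (a \<bullet> a) * (Z \<omega> \<bullet> Z \<omega>))"
    unfolding second_moment_def using assms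
    by (intro integral_mono integrable_mult_right L2_vec_integrable_inner_sq L2_vec_integrable_norm_sq)
      (auto simp: Cauchy_Schwarz_ineq)
  then show ?thesis by (simp add: norm_sq_mean_def mult.commute)
qed

lemma second_moment_add_le:
  assumes "L2_vec I Y" "L2_vec I Z"
  shows "second_moment (\<lambda>\<omega>. Y \<omega> + Z \<omega>) a \<le> 2 * second_moment Y a + 2 * second_moment Z a"
proof -
  have "second_moment (\<lambda>\<omega>. Y \<omega> + Z \<omega>) a \<le> expectation (\<lambda>\<omega>. 2 * (a \<bullet> Y \<omega>)\<^sup>2 + 2 * (a \<bullet> Z \<omega>)\<^sup>2)"
    unfolding second_moment_def using assms
  proof (intro integral_mono)
    show "integrable M (\<lambda>\<omega>. (a \<bullet> (Y \<omega> + Z \<omega>))\<^sup>2)"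
      by (rule L2_vec_integrable_inner_sq[OF L2_vec_add[OF assms]])
    show "(a \<bullet> (Y \<omega> + Z \<omega>))\<^sup>2 \<le> 2 * (a \<bullet> Y \<omega>)\<^sup>2 + 2 * (a \<bullet> Z \<omega>)\<^sup>2" for \<omega>
      using sum_squares_bound[of "a \<bullet> Y \<omega>" "a \<bullet> Z \<omega>"] by (simp add: inner_add_right power2_sum)
    show "integrable M (\<lambda>\<omega>. 2 * (a \<bullet> Y \<omega>)\<^sup>2 + 2 * (a \<bullet> Z \<omega>)\<^sup>2)"
      using assms[THEN L2_vec_integrable_inner_sq, of a] by simp
  qed
  also have "\<dots> = 2 * second_moment Y a + 2 * second_moment Z a"
    using assms by (simp add: second_moment_def L2_vec_integrable_inner_sq)
  finally show ?thesis .
qed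

definition ms_null :: "(nat \<Rightarrow> 'a \<Rightarrow> real^'k) \<Rightarrow> bool" where
  "ms_null Z \<longleftrightarrow> (\<forall>t. L2_vec UNIV (Z t)) \<and> (\<forall>a. (\<lambda>t. second_moment (Z t) a) \<longlonglongrightarrow> 0)"

lemma ms_null_cong:
  assumes "\<And>t \<omega>. \<omega> \<in> space M \<Longrightarrow> Y t \<omega> = Z t \<omega>"
  shows "ms_null Y \<longleftrightarrow> ms_null Z"
proof -
  have "L2_vec UNIV (Y t) = L2_vec UNIV (Z t)" for t
    by (intro L2_vec_cong assms)
  moreover have "second_moment (Y t) a = second_moment (Z t) a" for t a
    by (intro second_moment_cong assms)
  ultimately show ?thesis by (simp add: ms_null_def)
qed

lemma ms_null_matrix: "ms_null Z \<Longrightarrow> ms_null (\<lambda>t \<omega>. G *v Z t \<omega>)"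
  by (simp add: ms_null_def L2_vec_matrix second_moment_matrix)

lemma ms_null_add:
  assumes "ms_null Y" "ms_null Z" shows "ms_null (\<lambda>t \<omega>. Y t \<omega> + Z t \<omega>)"
  unfolding ms_null_def
proof (intro conjI allI)
  fix t show "L2_vec UNIV (\<lambda>\<omega>. Y t \<omega> + Z t \<omega>)"
    using assms by (simp add: ms_null_def L2_vec_add)
next
  fix a
  have lim: "(\<lambda>t. 2 * second_moment (Y t) a + 2 * second_moment (Z t) a) \<longlonglongrightarrow> 0"
    using assms unfolding ms_null_def by (intro tendsto_add_zero tendsto_mult_right_zero) auto
  have "norm (second_moment (\<lambda>\<omega>. Y t \<omega> + Z t \<omega>) a) \<le> 2 * second_moment (Y t) a + 2 * second_moment (Z t) a" for t
    using assms by (simp add: ms_null_def second_moment_add_le[of UNIV])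
  then show "(\<lambda>t. second_moment (\<lambda>\<omega>. Y t \<omega> + Z t \<omega>) a) \<longlonglongrightarrow> 0"
    by (rule Lim_null_comparison[OF always_eventually[OF allI] lim])
qed

lemma ms_null_sum:
  "finite S \<Longrightarrow> (\<And>s. s \<in> S \<Longrightarrow> ms_null (Z s)) \<Longrightarrow> ms_null (\<lambda>t \<omega>. \<Sum>s\<in>S. Z s t \<omega>)"
  by (induction S rule: finite_induct) (auto intro: ms_null_add simp: ms_null_def[of "\<lambda>_ _. 0"] second_moment_def)

lemma ms_null_iff_norm_sq_mean:
  assumes "\<And>t. L2_vec UNIV (Z t)"
  shows "ms_null Z \<longleftrightarrow> (\<lambda>t. norm_sq_mean (Z t)) \<longlonglongrightarrow> 0"
proof
  assume "ms_null Z"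
  then have "(\<lambda>t. \<Sum>i\<in>UNIV. second_moment (Z t) (axis i 1)) \<longlonglongrightarrow> 0"
    by (intro tendsto_null_sum) (auto simp: ms_null_def)
  then show "(\<lambda>t. norm_sq_mean (Z t)) \<longlonglongrightarrow> 0" by (simp add: norm_sq_mean_eq_sum[OF assms])
next
  assume lim: "(\<lambda>t. norm_sq_mean (Z t)) \<longlonglongrightarrow> 0"
  have "(\<lambda>t. second_moment (Z t) a) \<longlonglongrightarrow> 0" for a
  proof -
    have "norm (second_moment (Z t) a) \<le> norm_sq_mean (Z t) * (a \<bullet> a)" for t
      by (simp add: second_moment_le_norm_sq_mean[OF assms])
    then show ?thesis
      by (rule Lim_null_comparison[OF always_eventually[OF allI] tendsto_mult_left_zero[OF lim]])
  qed
  with assms show "ms_null Z" by (simp add: ms_null_def)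
qed

lemma ms_null_iff_mean_square:
  assumes "\<And>t. L2_vec UNIV (Z t)"
  shows "ms_null Z \<longleftrightarrow> (\<lambda>t. mean_square M (Z t)) \<longlonglongrightarrow> 0"
  using tendsto_ennreal_iff[of "\<lambda>t. norm_sq_mean (Z t)" sequentially 0]
  by (simp add: ms_null_iff_norm_sq_mean assms mean_square_eq_norm_sq_mean[OF assms])

definition cross_moment :: "('a \<Rightarrow> real^'k) \<Rightarrow> ('a \<Rightarrow> real^'l) \<Rightarrow> real^'l^'k" where
  "cross_moment Y Z = (\<chi> k l. expectation (\<lambda>\<omega>. Y \<omega> $ k * Z \<omega> $ l))"

lemma L2_vec_component: "L2_vec I Z \<Longrightarrow> L2 I (\<lambda>\<omega>. Z \<omega> $ k)"
  using L2_vec_inner[of I Z "axis k 1"] by (simp add: inner_axis')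

lemma inner_cross_moment:
  assumes Y: "L2_vec I Y" and Z: "L2_vec I Z"
  shows "b \<bullet> (cross_moment Y Z *v a) = expectation (\<lambda>\<omega>. (b \<bullet> Y \<omega>) * (a \<bullet> Z \<omega>))"
proof -
  have "expectation (\<lambda>\<omega>. (b \<bullet> Y \<omega>) * (a \<bullet> Z \<omega>))
     = expectation (\<lambda>\<omega>. \<Sum>k\<in>UNIV. \<Sum>l\<in>UNIV. (b $ k * a $ l) * (Y \<omega> $ k * Z \<omega> $ l))"
    by (simp add: inner_vec_def sum_product mult_ac)
  also have "\<dots> = (\<Sum>k\<in>UNIV. \<Sum>l\<in>UNIV. (b $ k * a $ l) * expectation (\<lambda>\<omega>. Y \<omega> $ k * Z \<omega> $ l))"
    by (simp add: L2_integrable_mult[OF L2_vec_component[OF Y] L2_vec_component[OF Z]])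
  also have "\<dots> = b \<bullet> (cross_moment Y Z *v a)"
    by (simp add: cross_moment_def inner_vec_def matrix_vector_mult_def sum_distrib_left mult_ac)
  finally show ?thesis by simp
qed

lemma transpose_cross_moment: "transpose (cross_moment Y Z) = cross_moment Z Y"
  by (simp add: cross_moment_def transpose_def mult.commute)

text \<open>
Finite sums of second-moment matrices of any square-integrable pairs \<open>(Y s, V s)\<close> are admissible as
\<open>X\<close>, \<open>F\<close>, \<open>U\<close>, so a certificate needs only the scalar inequality. In the application \<open>s\<close> ranges
over initial states and times.
\<close>

lemma moment_certificateI:
  fixes A :: "real^'n^'n" and B G H :: "real^'m^'n" and Y :: "'s \<Rightarrow> 'a \<Rightarrow> real^'n" and V :: "'s \<Rightarrow> 'a \<Rightarrow> real^'m"
  assumes Y: "\<And>s. L2_vec UNIV (Y s)" and V: "\<And>s. L2_vec UNIV (V s)" and "\<epsilon> > 0"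
    and ineq: "\<And>a. (\<Sum>s\<in>S. expectation (\<lambda>\<omega>. ((a v* A) \<bullet> Y s \<omega> + (a v* B) \<bullet> V s \<omega>)\<^sup>2))
      + s0 * (\<Sum>s\<in>S. second_moment (V s) (a v* G)) + sD * (\<Sum>s\<in>S. second_moment (V s) (a v* H)) + \<epsilon> * (a \<bullet> a)
      \<le> (\<Sum>s\<in>S. second_moment (Y s) a)"
  shows "moment_certificate A B G H s0 sD"
proof -
  define X where "X = (\<Sum>s\<in>S. cross_moment (Y s) (Y s))"
  define F where "F = (\<Sum>s\<in>S. cross_moment (V s) (Y s))"
  define U where "U = (\<Sum>s\<in>S. cross_moment (V s) (V s))"
  have qfX: "quad_form X a = (\<Sum>s\<in>S. second_moment (Y s) a)" for a
    by (simp add: X_def quad_form_def inner_sum_matrix inner_cross_moment[OF Y Y] second_moment_def power2_eq_square)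
  have qfU: "quad_form U b = (\<Sum>s\<in>S. second_moment (V s) b)" for b
    by (simp add: U_def quad_form_def inner_sum_matrix inner_cross_moment[OF V V] second_moment_def power2_eq_square)
  have joint: "joint_form X F U a b = (\<Sum>s\<in>S. expectation (\<lambda>\<omega>. (a \<bullet> Y s \<omega> + b \<bullet> V s \<omega>)\<^sup>2))" for a b
  proof -
    have "joint_form X F U a b = (\<Sum>s\<in>S. second_moment (Y s) a + 2 * expectation (\<lambda>\<omega>. (b \<bullet> V s \<omega>) * (a \<bullet> Y s \<omega>)) + second_moment (V s) b)"
      by (simp add: joint_form_def qfX qfU F_def inner_sum_matrix inner_cross_moment[OF V Y] 
          sum.distrib sum_distrib_left)
    also have "\<dots> = (\<Sum>s\<in>S. expectation (\<lambda>\<omega>. (a \<bullet> Y s \<omega> + b \<bullet> V s \<omega>)\<^sup>2))"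
    proof (intro sum.cong refl)
      fix s
      have "expectation (\<lambda>\<omega>. (a \<bullet> Y s \<omega> + b \<bullet> V s \<omega>)\<^sup>2) = expectation (\<lambda>\<omega>. (a \<bullet> Y s \<omega>)\<^sup>2 +
        2 * ((b \<bullet> V s \<omega>) * (a \<bullet> Y s \<omega>)) + (b \<bullet> V s \<omega>)\<^sup>2)"
        by (simp add: power2_sum mult_ac add_ac)
      then show "second_moment (Y s) a + 2 * expectation (\<lambda>\<omega>. (b \<bullet> V s \<omega>) * (a \<bullet> Y s \<omega>)) + second_moment (V s) b
        = expectation (\<lambda>\<omega>. (a \<bullet> Y s \<omega> + b \<bullet> V s \<omega>)\<^sup>2)"
        using L2_vec_integrable_inner_sq[OF Y] L2_vec_integrable_inner_sq[OF V]
          L2_integrable_mult[OF L2_vec_inner[OF V] L2_vec_inner[OF Y]]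
        by (simp add: second_moment_def)
    qed
    finally show ?thesis .
  qed
  show ?thesis
    unfolding moment_certificate_def
  proof (intro exI conjI allI)
    show "transpose X = X" "transpose U = U"
      by (simp_all add: X_def U_def transpose_sum transpose_cross_moment)
    show "0 \<le> joint_form X F U a b" for a b
      by (simp add: joint sum_nonneg)
    show "joint_form X F U (a v* A) (a v* B) + s0 * quad_form U (a v* G) + sD * quad_form U (a v* H) + \<epsilon> * (a \<bullet> a)
      \<le> quad_form X a" for a
      using ineq[of a] by (simp add: joint qfX qfU)
  qed fact
qed

end

section \<open>The closed loop and its predictor\<close>

text \<open>
The labels of the noise that acts strictly before time \<open>t\<close>, hence the noise that \<open>x t\<close> depends on.
\<close>

definition history :: "nat \<Rightarrow> (nat + nat) set" where
  "history t = Inl ` {..<t} \<union> Inr ` {..<t}"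

lemma history_simps [simp]: "Inl s \<in> history t \<longleftrightarrow> s < t" "Inr s \<in> history t \<longleftrightarrow> s < t"
  by (auto simp: history_def)

lemma history_mono: "s \<le> t \<Longrightarrow> history s \<subseteq> history t"
  by (auto simp: history_def)

lemma history_Suc: "history (Suc t) = insert (Inr t) (insert (Inl t) (history t))"
  by (auto simp: history_def lessThan_Suc)

lemma (in noise_channels) noise_filtration_eq: "noise_filtration M w0 wD t = info (history (Suc t))"
proof -
  have "(\<Union>s\<le>t. {w0 s -` S \<inter> space M |S. S \<in> sets borel} \<union> {wD s -` S \<inter> space M |S. S \<in> sets borel})
     = (\<Union>i\<in>history (Suc t). events_of i)"
    by (simp add: history_def image_Un UN_Un UN_Un_distrib events_of_def lessThan_Suc_atMost image_image)
  then show ?thesis by (simp add: noise_filtration_def info_def)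
qed

lemma sum_lessThan_add: "(\<Sum>t<m + k. f t) = (\<Sum>t<m. f t) + (\<Sum>j<k. f (m + j))"
  for f :: "nat \<Rightarrow> real"
  by (induction k) simp_all

text \<open>
A trajectory under a feedback law with arbitrary constant gains. The letters \<open>G\<close> and \<open>H\<close> stand for
the noise directions \<open>C0\<close> and \<open>C\<close>.
\<close>

locale closed_loop = noise_channels M w0 wD \<sigma>0 \<sigma>D
  for M :: "'a measure" and w0 wD :: "nat \<Rightarrow> 'a \<Rightarrow> real" and \<sigma>0 \<sigma>D :: real +
  fixes A :: "real^'n^'n" and B G H :: "real^'m^'n" and D :: nat
    and K0 :: "real^'n^'m" and K :: "nat \<Rightarrow> real^'m^'m"
    and x :: "nat \<Rightarrow> 'a \<Rightarrow> real^'n" and u :: "int \<Rightarrow> 'a \<Rightarrow> real^'m"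
    and \<xi>0 :: "real^'n" and \<phi> :: "int \<Rightarrow> real^'m"
  assumes initial_state: "\<omega> \<in> space M \<Longrightarrow> x 0 \<omega> = \<xi>0"
    and initial_control: "s \<in> {- int D..-1} \<Longrightarrow> \<omega> \<in> space M \<Longrightarrow> u s \<omega> = \<phi> s"
    and dynamics: "\<omega> \<in> space M \<Longrightarrow>
      x (Suc t) \<omega> = delayed_dynamics A G B H w0 wD D t \<omega> (x t \<omega>) (\<lambda>s. u s \<omega>)"
    and feedback: "feedback_law M D K0 K x u"
begin

lemma control_adapted:
  assumes "L2_vec I (x t)" and "\<And>s. - int D \<le> s \<Longrightarrow> s < int t \<Longrightarrow> L2_vec I (u s)"
  shows "L2_vec I (u (int t))"
proof -
  have "L2_vec I (\<lambda>\<omega>. K0 *v x t \<omega> + (\<Sum>\<tau>=1..D. K \<tau> *v u (int t - int \<tau>) \<omega>))"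
    by (intro L2_vec_add L2_vec_sum L2_vec_matrix assms) auto
  then show ?thesis
    using feedback by (subst L2_vec_cong) (auto simp: feedback_law_def)
qed

lemma next_state:
  assumes "\<omega> \<in> space M"
  shows "x (Suc t) \<omega> = (A *v x t \<omega> + B *v u (int t - int D) \<omega>)
    + noise (Inl t) \<omega> *\<^sub>R (G *v u (int t) \<omega>) + noise (Inr t) \<omega> *\<^sub>R (H *v u (int t - int D) \<omega>)"
  using dynamics[OF assms]
  by (simp add: delayed_dynamics_def matrix_vector_mult_add_rdistrib flip: scaleR_matrix_vector_assoc)

text \<open>
Measurability of \<open>u t\<close> with respect to the noise up to time \<open>t\<close> would allow it to depend on the
noise by which it is multiplied in the state equation. The feedback law excludes this: it expresses
\<open>u t\<close> through \<open>x t\<close> and earlier controls, which know only the noise before \<open>t\<close>.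
\<close>

lemma adapted:
  "L2_vec (history t) (x t) \<and> (\<forall>s. - int D \<le> s \<longrightarrow> s \<le> int t \<longrightarrow> L2_vec (history t) (u s))"
proof (induction t)
  case 0
  have x: "L2_vec (history 0) (x 0)"
    using L2_vec_cong[of "x 0" "\<lambda>_. \<xi>0"] initial_state by simp
  have u: "L2_vec (history 0) (u s)" if "- int D \<le> s" "s < 0" for s
    using L2_vec_cong[of "u s" "\<lambda>_. \<phi> s"] initial_control[of s] that by simp
  have "L2_vec (history 0) (u s)" if "- int D \<le> s" "s \<le> 0" for s
    using control_adapted[OF x] u that by (cases "s = 0") auto
  with x show ?case by simp
next
  case (Suc t)
  have "L2_vec (history (Suc t)) (\<lambda>\<omega>. (A *v x t \<omega> + B *v u (int t - int D) \<omega>)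
    + noise (Inl t) \<omega> *\<^sub>R (G *v u (int t) \<omega>) + noise (Inr t) \<omega> *\<^sub>R (H *v u (int t - int D) \<omega>))"
    unfolding history_Suc using Suc by (intro L2_vec_noise_step L2_vec_add L2_vec_matrix) auto
  then have x: "L2_vec (history (Suc t)) (x (Suc t))"
    by (rule L2_vec_cong[THEN iffD2, rotated]) (rule next_state)
  have u: "L2_vec (history (Suc t)) (u s)" if "- int D \<le> s" "s \<le> int t" for s
    using Suc that L2_vec_mono[OF _ history_mono[of t "Suc t"]] by auto
  have "L2_vec (history (Suc t)) (u s)" if "- int D \<le> s" "s \<le> int (Suc t)" for s
    using control_adapted[OF x] u that by (cases "s = int (Suc t)") auto
  with x show ?case by blast
qed

lemma x_adapted: "L2_vec (history t) (x t)"
  using adapted by blast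

lemma u_adapted: "- int D \<le> s \<Longrightarrow> s \<le> int t \<Longrightarrow> L2_vec (history t) (u s)"
  using adapted by blast

definition predictor :: "nat \<Rightarrow> 'a \<Rightarrow> real^'n" where
  "predictor t \<omega> = mpow A D *v x t \<omega> + (\<Sum>j<D. mpow A j *v (B *v u (int t - 1 - int j) \<omega>))"

lemma predictor_adapted: "L2_vec (history t) (predictor t)"
  unfolding predictor_def
  by (intro L2_vec_add L2_vec_sum L2_vec_matrix x_adapted u_adapted) auto

text \<open>
The delayed input \<open>A^D B u (t - D)\<close> that the state receives is the one term that \<open>A\<close> times the sum
of stored inputs contains and the next such sum does not; conversely, \<open>B u t\<close> is the one new term.
\<close>

lemma predictor_step:
  assumes "\<omega> \<in> space M"
  shows "predictor (Suc t) \<omega> = (A *v predictor t \<omega> + B *v u (int t) \<omega>)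
    + noise (Inl t) \<omega> *\<^sub>R (mpow A D *v (G *v u (int t) \<omega>))
    + noise (Inr t) \<omega> *\<^sub>R (mpow A D *v (H *v u (int t - int D) \<omega>))"
proof -
  define g where "g j = mpow A j *v (B *v u (int t - int j) \<omega>)" for j
  have "A *v (\<Sum>j<D. mpow A j *v (B *v u (int t - 1 - int j) \<omega>)) = (\<Sum>j<D. g (Suc j))"
    by (simp add: g_def linear_sum[OF matrix_vector_mul_linear] matrix_vector_mul_assoc matrix_mul_assoc algebra_simps)
  moreover have "(\<Sum>j<D. g (Suc j)) + g 0 = (\<Sum>j<D. g j) + g D"
    using sum.lessThan_Suc_shift[of g D] by (simp add: add.commute)
  ultimately have shift: "A *v (\<Sum>j<D. mpow A j *v (B *v u (int t - 1 - int j) \<omega>)) + B *v u (int t) \<omega>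
     = (\<Sum>j<D. g j) + mpow A D *v (B *v u (int t - int D) \<omega>)"
    by (simp add: g_def)
  have "predictor (Suc t) \<omega> = mpow A D *v x (Suc t) \<omega> + (\<Sum>j<D. g j)"
    by (simp add: predictor_def g_def)
  also have "mpow A D *v x (Suc t) \<omega> = A *v (mpow A D *v x t \<omega>) + mpow A D *v (B *v u (int t - int D) \<omega>)
    + noise (Inl t) \<omega> *\<^sub>R (mpow A D *v (G *v u (int t) \<omega>))
    + noise (Inr t) \<omega> *\<^sub>R (mpow A D *v (H *v u (int t - int D) \<omega>))"
    by (simp add: next_state[OF assms] matrix_vector_right_distrib matrix_vector_mult_scaleR
        matrix_vector_mul_assoc mpow_commute)
  finally show ?thesis
    using shift by (simp add: predictor_def matrix_vector_right_distrib algebra_simps)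
qed

lemma predictor_moment:
  "second_moment (predictor (Suc t)) a
    = expectation (\<lambda>\<omega>. ((a v* A) \<bullet> predictor t \<omega> + (a v* B) \<bullet> u (int t) \<omega>)\<^sup>2)
      + \<sigma>0\<^sup>2 * second_moment (u (int t)) (a v* (mpow A D ** G))
      + \<sigma>D\<^sup>2 * second_moment (u (int t - int D)) (a v* (mpow A D ** H))"
proof -
  have "second_moment (predictor (Suc t)) a = second_moment (\<lambda>\<omega>. (A *v predictor t \<omega> + B *v u (int t) \<omega>)
    + noise (Inl t) \<omega> *\<^sub>R (mpow A D *v (G *v u (int t) \<omega>))
    + noise (Inr t) \<omega> *\<^sub>R (mpow A D *v (H *v u (int t - int D) \<omega>))) a"
    by (rule second_moment_cong) (rule predictor_step)
  also have "\<dots> = second_moment (\<lambda>\<omega>. A *v predictor t \<omega> + B *v u (int t) \<omega>) a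
    + noise_var (Inl t) * second_moment (\<lambda>\<omega>. mpow A D *v (G *v u (int t) \<omega>)) a
    + noise_var (Inr t) * second_moment (\<lambda>\<omega>. mpow A D *v (H *v u (int t - int D) \<omega>)) a"
    by (rule second_moment_noise_step[where I = "history t"])
      (auto intro!: L2_vec_add L2_vec_matrix predictor_adapted u_adapted)
  also have "second_moment (\<lambda>\<omega>. A *v predictor t \<omega> + B *v u (int t) \<omega>) a
    = expectation (\<lambda>\<omega>. ((a v* A) \<bullet> predictor t \<omega> + (a v* B) \<bullet> u (int t) \<omega>)\<^sup>2)"
    by (simp add: second_moment_def inner_add_right dot_lmul_matrix)
  finally show ?thesis
    by (simp add: second_moment_matrix noise_var_def vector_matrix_mul_assoc)
qed

lemma x_L2: "L2_vec UNIV (x t)" and u_L2: "- int D \<le> s \<Longrightarrow> L2_vec UNIV (u s)"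
  and predictor_L2: "L2_vec UNIV (predictor t)"
  using L2_vec_mono[OF x_adapted] L2_vec_mono[OF predictor_adapted] L2_vec_mono[OF u_adapted[of s "nat \<bar>s\<bar>"]]
  by auto

lemma past_control_ms_null:
  assumes "ms_null (\<lambda>t. u (int t))" and "j < D"
  shows "ms_null (\<lambda>t. u (int t - 1 - int j))"
  unfolding ms_null_def
proof (intro conjI allI)
  show "L2_vec UNIV (u (int t - 1 - int j))" for t
    using \<open>j < D\<close> by (intro u_L2) auto
next
  fix a
  have "(\<lambda>t. second_moment (u (int (t + Suc j) - 1 - int j)) a) \<longlonglongrightarrow> 0"
    using assms(1) by (simp add: ms_null_def)
  then show "(\<lambda>t. second_moment (u (int t - 1 - int j)) a) \<longlonglongrightarrow> 0"
    by (rule LIMSEQ_offset)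
qed

lemma control_ms_null:
  assumes "(\<Sum>t. mean_square M (u (int t))) < \<infinity>"
  shows "ms_null (\<lambda>t. u (int t))"
proof -
  have L: "L2_vec UNIV (u (int t))" for t by (rule u_L2) simp
  have "(\<Sum>t. ennreal (norm_sq_mean (u (int t)))) < \<infinity>"
    using assms by (simp add: mean_square_eq_norm_sq_mean[OF L])
  then have "summable (\<lambda>t. norm_sq_mean (u (int t)))"
    by (intro summable_suminf_not_top) auto
  then show ?thesis
    using summable_LIMSEQ_zero by (simp add: ms_null_iff_norm_sq_mean L)
qed

lemma predictor_ms_null:
  assumes "ms_null x" "ms_null (\<lambda>t. u (int t))"
  shows "ms_null predictor"
  unfolding predictor_def using assms
  by (intro ms_null_add ms_null_sum ms_null_matrix past_control_ms_null) auto

text \<open>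
The recursion of the predictor summed over \<open>t < N + D\<close>. The sum over the undelayed controls exceeds
the one over the delayed controls by at most its last \<open>D\<close> terms, which appear on the right as an
error term.
\<close>

lemma truncated_balance:
  fixes N :: nat
  defines "T \<equiv> N + D"
  shows "(\<Sum>t<T. expectation (\<lambda>\<omega>. ((a v* A) \<bullet> predictor t \<omega> + (a v* B) \<bullet> u (int t) \<omega>)\<^sup>2))
      + \<sigma>0\<^sup>2 * (\<Sum>t<T. second_moment (u (int t)) (a v* (mpow A D ** G)))
      + \<sigma>D\<^sup>2 * (\<Sum>t<T. second_moment (u (int t)) (a v* (mpow A D ** H)))
      + second_moment (predictor 0) a
    \<le> (\<Sum>t<T. second_moment (predictor t) a) + second_moment (predictor T) a
      + \<sigma>D\<^sup>2 * (\<Sum>j<D. second_moment (u (int (N + j))) (a v* (mpow A D ** H)))"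
proof -
  let ?J = "\<lambda>t. expectation (\<lambda>\<omega>. ((a v* A) \<bullet> predictor t \<omega> + (a v* B) \<bullet> u (int t) \<omega>)\<^sup>2)"
  let ?g = "\<lambda>s. second_moment (u s) (a v* (mpow A D ** G))" and ?h = "\<lambda>s. second_moment (u s) (a v* (mpow A D ** H))"
  have "(\<Sum>t<T. second_moment (predictor (Suc t)) a) + second_moment (predictor 0) a
     = (\<Sum>t<T. second_moment (predictor t) a) + second_moment (predictor T) a"
    using sum.lessThan_Suc_shift[of "\<lambda>t. second_moment (predictor t) a" T] by simp
  moreover have "(\<Sum>t<T. second_moment (predictor (Suc t)) a)
     = (\<Sum>t<T. ?J t) + \<sigma>0\<^sup>2 * (\<Sum>t<T. ?g (int t)) + \<sigma>D\<^sup>2 * (\<Sum>t<T. ?h (int t - int D))"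
    by (simp add: predictor_moment sum.distrib sum_distrib_left)
  moreover have "(\<Sum>t<T. ?h (int t)) \<le> (\<Sum>t<T. ?h (int t - int D)) + (\<Sum>j<D. ?h (int (N + j)))"
  proof -
    have "(\<Sum>t<T. ?h (int t)) = (\<Sum>t<N. ?h (int t)) + (\<Sum>j<D. ?h (int (N + j)))"
      unfolding T_def by (rule sum_lessThan_add)
    moreover have "(\<Sum>t<T. ?h (int t - int D)) = (\<Sum>t<D. ?h (int t - int D)) + (\<Sum>t<N. ?h (int t))"
      using sum_lessThan_add[of "\<lambda>t. ?h (int t - int D)" D N] by (simp add: T_def add.commute)
    \<comment> \<open>The first D delayed terms involve only initial data and are dropped.\<close>
    ultimately show ?thesis using sum_nonneg[of "{..<D}" "\<lambda>t. ?h (int t - int D)"] by simp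
  qed
  from mult_left_mono[OF this, of "\<sigma>D\<^sup>2"] 
  have "\<sigma>D\<^sup>2 * (\<Sum>t<T. ?h (int t)) \<le> \<sigma>D\<^sup>2 * (\<Sum>t<T. ?h (int t - int D)) + \<sigma>D\<^sup>2 * (\<Sum>j<D. ?h (int (N + j)))"
    by (simp add: distrib_left)
  ultimately show ?thesis by linarith
qed

end

section \<open>Stabilizability yields a certificate\<close>

context noise_channels
begin

lemma closed_loop_of_stabilizable:
  fixes A :: "real^'n^'n" and B G H :: "real^'m^'n"
  assumes "delayed_stabilizable M w0 wD A G B H D"
  obtains K0 K x u where
    "\<And>i. closed_loop M w0 wD \<sigma>0 \<sigma>D A B G H D K0 K (x i) (u i) (axis i 1) (\<lambda>_. 0)"
    "\<And>i. (\<Sum>t. mean_square M (u i (int t))) < \<infinity>"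
    "\<And>i. (\<lambda>t. mean_square M (x i t)) \<longlonglongrightarrow> 0"
proof -
  from assms obtain K0 K where *: "\<And>(\<xi>0::real^'n) (\<phi>::int \<Rightarrow> real^'m).
     \<exists>(x::nat \<Rightarrow> 'a \<Rightarrow> real^'n) (u::int \<Rightarrow> 'a \<Rightarrow> real^'m).
            (\<forall>\<omega>\<in>space M. x 0 \<omega> = \<xi>0) \<and>
            (\<forall>s\<in>{- int D..-1}. \<forall>\<omega>\<in>space M. u s \<omega> = \<phi> s) \<and>
            (\<forall>t. \<forall>\<omega>\<in>space M. x (Suc t) \<omega> = delayed_dynamics A G B H w0 wD D t \<omega> (x t \<omega>) (\<lambda>s. u s \<omega>)) \<and>
            admissible_control M w0 wD D K0 K x u \<and>
            (\<lambda>t. mean_square M (x t)) \<longlonglongrightarrow> 0"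
    unfolding delayed_stabilizable_def ms_stabilizable_def by blast
  have "\<exists>x u. closed_loop M w0 wD \<sigma>0 \<sigma>D A B G H D K0 K x u (axis i 1) (\<lambda>_. 0) \<and>
      (\<Sum>t. mean_square M (u (int t))) < \<infinity> \<and> (\<lambda>t. mean_square M (x t)) \<longlonglongrightarrow> 0" for i
  proof -
    from *[of "axis i 1" "\<lambda>_. 0"] obtain x u where
      "\<forall>\<omega>\<in>space M. x 0 \<omega> = axis i 1" "\<forall>s\<in>{- int D..-1}. \<forall>\<omega>\<in>space M. u s \<omega> = 0"
      "\<forall>t. \<forall>\<omega>\<in>space M. x (Suc t) \<omega> = delayed_dynamics A G B H w0 wD D t \<omega> (x t \<omega>) (\<lambda>s. u s \<omega>)"
      "admissible_control M w0 wD D K0 K x u" "(\<lambda>t. mean_square M (x t)) \<longlonglongrightarrow> 0"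
      by blast
    then show ?thesis
      by (intro exI[of _ x] exI[of _ u] conjI closed_loop.intro closed_loop_axioms.intro noise_channels_axioms)
        (auto simp: admissible_control_def)
  qed
  then show thesis using that by metis
qed

text \<open>
One trajectory is started at each basis vector, with zero initial control, so that the initial
predictors \<open>A^D e_i\<close> have a positive definite sum of second moments; this uses that \<open>A\<close> is invertible.
Stabilizability says only that the state tends to zero in mean square, which does not state that its
second moments are summable, so the sums are cut off at a time \<open>N + D\<close> at which the boundary terms are
at most half of the initial second moment.
\<close>

lemma stabilizable_imp_moment_certificate:
  fixes A :: "real^'n^'n" and B G H :: "real^'m^'n"
  assumes "invertible A" and "delayed_stabilizable M w0 wD A G B H D"
  shows "moment_certificate A B (mpow A D ** G) (mpow A D ** H) (\<sigma>0\<^sup>2) (\<sigma>D\<^sup>2)"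
proof -
  obtain K0 K x u where loops:
    "\<And>i. closed_loop M w0 wD \<sigma>0 \<sigma>D A B G H D K0 K (x i) (u i) (axis i 1) (\<lambda>_. 0)"
    and u_sum: "\<And>i. (\<Sum>t. mean_square M (u i (int t))) < \<infinity>"
    and x_lim: "\<And>i. (\<lambda>t. mean_square M (x i t)) \<longlonglongrightarrow> 0"
    using closed_loop_of_stabilizable[OF assms(2)] by blast
  interpret cl: closed_loop M w0 wD \<sigma>0 \<sigma>D A B G H D K0 K "x i" "u i" "axis i 1" "\<lambda>_. 0" for i :: 'n
    by (rule loops)
  define y where "y = cl.predictor"
  have yL: "L2_vec UNIV (y i t)" and uL: "L2_vec UNIV (u i (int t))" for i t
    by (simp_all add: y_def cl.predictor_L2 cl.u_L2)
  have u_null: "ms_null (\<lambda>t. u i (int t))" for i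
    by (rule cl.control_ms_null[OF u_sum])
  have y_null: "ms_null (y i)" for i
    unfolding y_def
    by (intro cl.predictor_ms_null u_null) (simp add: ms_null_iff_mean_square cl.x_L2 x_lim)
  have y_lim: "(\<lambda>t. norm_sq_mean (y i t)) \<longlonglongrightarrow> 0" and u_lim: "(\<lambda>t. norm_sq_mean (u i (int t))) \<longlonglongrightarrow> 0" for i
    using y_null[of i] u_null[of i] by (simp_all add: ms_null_iff_norm_sq_mean yL uL)
  obtain c where c: "c > 0" "\<And>a. (a v* (mpow A D ** H)) \<bullet> (a v* (mpow A D ** H)) \<le> c * (a \<bullet> a)"
    using vector_matrix_bound by blast
  obtain Ai where Ai: "mpow A D ** Ai = mat 1"
    using invertible_mpow[OF assms(1)] unfolding invertible_def by blast
  obtain d where d: "d > 0" "\<And>b. (b v* Ai) \<bullet> (b v* Ai) \<le> d * (b \<bullet> b)"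
    using vector_matrix_bound by blast
  have y0: "(\<Sum>i\<in>UNIV. second_moment (y i 0) a) = (a v* mpow A D) \<bullet> (a v* mpow A D)" for a
  proof -
    have "y i 0 \<omega> = mpow A D *v axis i 1" if "\<omega> \<in> space M" for i \<omega>
      using cl.initial_state[OF that] cl.initial_control[OF _ that] by (simp add: y_def cl.predictor_def)
    then have "second_moment (y i 0) a = second_moment (\<lambda>_. mpow A D *v axis i 1) a" for i
      by (intro second_moment_cong) auto
    then show ?thesis
      by (simp add: second_moment_def prob_space inner_self_axis[of "a v* mpow A D"] inner_commute flip: dot_lmul_matrix)
  qed
  have y0_ge: "(a \<bullet> a) / d \<le> (\<Sum>i\<in>UNIV. second_moment (y i 0) a)" for a
    using d(2)[of "a v* mpow A D"] d(1)
    by (simp add: y0 vector_matrix_mul_assoc Ai field_simps)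
  define \<tau> where "\<tau> i N = norm_sq_mean (y i (N + D)) + \<sigma>D\<^sup>2 * (\<Sum>j<D. c * norm_sq_mean (u i (int (N + j))))" for i N
  define \<delta> where "\<delta> N = (\<Sum>i\<in>UNIV. \<tau> i N)" for N
  \<comment> \<open>The boundary terms are at most \<open>\<delta> N * (a \<bullet> a)\<close>, against the initial term \<open>(a \<bullet> a) / d\<close>.\<close>
  have "\<delta> \<longlonglongrightarrow> 0"
    unfolding \<delta>_def \<tau>_def using y_lim u_lim
    by (intro tendsto_null_sum tendsto_add_zero tendsto_mult_right_zero) (rule LIMSEQ_ignore_initial_segment; simp)+
  then have "\<forall>\<^sub>F N in sequentially. \<delta> N < 1 / (2 * d)"
    using d(1) by (intro order_tendstoD) auto
  then obtain N where N: "\<delta> N < 1 / (2 * d)"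
    by (metis eventually_sequentially order_refl)
  let ?S = "(UNIV :: 'n set) \<times> {..<N + D}"
  show ?thesis
  proof (rule moment_certificateI[where S = ?S and \<epsilon> = "1 / (2 * d)"
        and Y = "\<lambda>(i, t). y i t" and V = "\<lambda>(i, t). u i (int t)"])
    fix a
    let ?h = "a v* (mpow A D ** H)" and ?g = "a v* (mpow A D ** G)"
    let ?J = "\<lambda>i t. expectation (\<lambda>\<omega>. ((a v* A) \<bullet> y i t \<omega> + (a v* B) \<bullet> u i (int t) \<omega>)\<^sup>2)"
    have tail: "second_moment (y i (N + D)) a + \<sigma>D\<^sup>2 * (\<Sum>j<D. second_moment (u i (int (N + j))) ?h)
       \<le> \<tau> i N * (a \<bullet> a)" for i
    proof -
      have "second_moment (u i (int s)) ?h \<le> c * norm_sq_mean (u i (int s)) * (a \<bullet> a)" for s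
      proof -
        have "second_moment (u i (int s)) ?h \<le> norm_sq_mean (u i (int s)) * (?h \<bullet> ?h)"
          by (rule second_moment_le_norm_sq_mean[OF uL])
        also have "\<dots> \<le> norm_sq_mean (u i (int s)) * (c * (a \<bullet> a))"
          using c(2) by (intro mult_left_mono) auto
        finally show ?thesis by (simp add: mult_ac)
      qed
      then have "\<sigma>D\<^sup>2 * (\<Sum>j<D. second_moment (u i (int (N + j))) ?h) \<le> \<sigma>D\<^sup>2 * (\<Sum>j<D. c * norm_sq_mean (u i (int (N + j))) * (a \<bullet> a))"
        by (intro mult_left_mono sum_mono) (auto simp del: of_nat_add)
      then show ?thesis
        using second_moment_le_norm_sq_mean[OF yL, of i "N + D" a] by (simp add: \<tau>_def distrib_right sum_distrib_right mult.assoc)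
    qed
    have "(\<Sum>t<N + D. ?J i t) + \<sigma>0\<^sup>2 * (\<Sum>t<N + D. second_moment (u i (int t)) ?g)
       + \<sigma>D\<^sup>2 * (\<Sum>t<N + D. second_moment (u i (int t)) ?h) + second_moment (y i 0) a
       \<le> (\<Sum>t<N + D. second_moment (y i t) a) + \<tau> i N * (a \<bullet> a)" for i
      using cl.truncated_balance[of a i N] tail[of i] unfolding y_def by linarith
    then have "(\<Sum>i\<in>UNIV. (\<Sum>t<N + D. ?J i t) + \<sigma>0\<^sup>2 * (\<Sum>t<N + D. second_moment (u i (int t)) ?g)
       + \<sigma>D\<^sup>2 * (\<Sum>t<N + D. second_moment (u i (int t)) ?h) + second_moment (y i 0) a)
       \<le> (\<Sum>i\<in>UNIV. (\<Sum>t<N + D. second_moment (y i t) a) + \<tau> i N * (a \<bullet> a))"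
      by (intro sum_mono)
    then have "(\<Sum>i\<in>UNIV. \<Sum>t<N + D. ?J i t) + \<sigma>0\<^sup>2 * (\<Sum>i\<in>UNIV. \<Sum>t<N + D. second_moment (u i (int t)) ?g)
       + \<sigma>D\<^sup>2 * (\<Sum>i\<in>UNIV. \<Sum>t<N + D. second_moment (u i (int t)) ?h) + (\<Sum>i\<in>UNIV. second_moment (y i 0) a)
       \<le> (\<Sum>i\<in>UNIV. \<Sum>t<N + D. second_moment (y i t) a) + \<delta> N * (a \<bullet> a)"
      unfolding \<delta>_def by (simp only: sum.distrib sum_distrib_left sum_distrib_right)
    moreover have "\<delta> N * (a \<bullet> a) \<le> 1 / (2 * d) * (a \<bullet> a)"
      using N by (intro mult_right_mono) auto
    moreover have "1 / (2 * d) * (a \<bullet> a) + 1 / (2 * d) * (a \<bullet> a) = (a \<bullet> a) / d"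
      by (simp add: field_simps)
    ultimately have "(\<Sum>i\<in>UNIV. \<Sum>t<N + D. ?J i t) + \<sigma>0\<^sup>2 * (\<Sum>i\<in>UNIV. \<Sum>t<N + D. second_moment (u i (int t)) ?g)
       + \<sigma>D\<^sup>2 * (\<Sum>i\<in>UNIV. \<Sum>t<N + D. second_moment (u i (int t)) ?h) + 1 / (2 * d) * (a \<bullet> a)
       \<le> (\<Sum>i\<in>UNIV. \<Sum>t<N + D. second_moment (y i t) a)"
      using y0_ge[of a] by linarith
    then show "(\<Sum>s\<in>?S. expectation (\<lambda>\<omega>. ((a v* A) \<bullet> (case s of (i, t) \<Rightarrow> y i t) \<omega> +
          (a v* B) \<bullet> (case s of (i, t) \<Rightarrow> u i (int t)) \<omega>)\<^sup>2))
      + \<sigma>0\<^sup>2 * (\<Sum>s\<in>?S. second_moment (case s of (i, t) \<Rightarrow> u i (int t)) ?g)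
      + \<sigma>D\<^sup>2 * (\<Sum>s\<in>?S. second_moment (case s of (i, t) \<Rightarrow> u i (int t)) ?h) + 1 / (2 * d) * (a \<bullet> a)
      \<le> (\<Sum>s\<in>?S. second_moment (case s of (i, t) \<Rightarrow> y i t) a)"
      unfolding sum.cartesian_product by (simp add: case_prod_unfold)
  qed (use d(1) yL uL in \<open>auto split: prod.splits\<close>)
qed

end

section \<open>A certificate yields a stabilizing gain\<close>

text \<open>
A delay does not destroy the decay of a positive recursion: if the undelayed recursion contracts the
form \<open>X\<close> by the factor \<open>1 - e\<close>, the delayed one still decays at any rate \<open>r\<close> in \<open>(0, 1)\<close> with
\<open>1 - e \<le> r^(D + 1)\<close>, because replacing \<open>r^t\<close> by \<open>r^(t - D)\<close> costs at most \<open>D\<close> powers of \<open>r\<close>. The first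
values \<open>Y 0, \<dots>, Y D\<close> are unconstrained, because up to then the recursion involves initial data,
and are absorbed in the constant.
\<close>

lemma delayed_lyapunov_decay:
  fixes Y :: "nat \<Rightarrow> real^'n \<Rightarrow> real" and f g h :: "real^'n \<Rightarrow> real^'n"
  assumes bound: "\<And>t. \<exists>\<gamma>. \<forall>a. Y t a \<le> \<gamma> * (a \<bullet> a)"
    and rec: "\<And>t a. D \<le> t \<Longrightarrow> Y (Suc t) a \<le> Y t (f a) + s0 * Y t (g a) + sD * Y (t - D) (h a)"
    and contr: "\<And>a. quad_form X (f a) + s0 * quad_form X (g a) + sD * quad_form X (h a) + \<epsilon> * (a \<bullet> a) \<le> quad_form X a"
    and coercive: "\<And>a. \<epsilon> * (a \<bullet> a) \<le> quad_form X a"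
    and "\<epsilon> > 0" "s0 \<ge> 0" "sD \<ge> 0"
  obtains c r where "0 < r" "r < 1" "\<And>t a. Y t a \<le> c * r ^ t * (a \<bullet> a)"
proof -
  obtain q0 where q0: "\<And>a. quad_form X a \<le> q0 * (a \<bullet> a)" using quad_form_bound by blast
  \<comment> \<open>Enlarging the bound keeps \<open>e\<close> at most 1/2, so that \<open>r\<close> is positive.\<close>
  define q where "q = max q0 (2 * \<epsilon>)"
  have q: "quad_form X a \<le> q * (a \<bullet> a)" for a
    using q0[of a] mult_right_mono[of q0 q "a \<bullet> a"] by (simp add: q_def)
  have "q \<ge> 2 * \<epsilon>" "q > 0" using \<open>\<epsilon> > 0\<close> by (auto simp: q_def)
  have Xpos: "0 \<le> quad_form X a" for a
    using coercive[of a] \<open>\<epsilon> > 0\<close> by (meson inner_ge_zero less_imp_le mult_nonneg_nonneg order_trans)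
  define e where "e = \<epsilon> / q"
  have e: "0 < e" "e \<le> 1 / 2"
    using \<open>q \<ge> 2 * \<epsilon>\<close> \<open>q > 0\<close> \<open>\<epsilon> > 0\<close> by (auto simp: e_def field_simps)
  define r where "r = 1 - e / real (Suc D)"
  have "e / real (Suc D) \<le> e / 1" using e by (intro divide_left_mono) auto
  then have r: "0 < r" "r < 1" using e by (auto simp: r_def)
  have r_pow: "1 - e \<le> r ^ Suc D"
    using Bernoulli_inequality[of "- (e / real (Suc D))" "Suc D"] r by (simp add: r_def del: power_Suc)
  have contr': "quad_form X (f a) + s0 * quad_form X (g a) + sD * quad_form X (h a) \<le> r ^ Suc D * quad_form X a" for a
  proof -
    have "e * quad_form X a \<le> e * (q * (a \<bullet> a))" using q e by (intro mult_left_mono) auto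
    also have "\<dots> = \<epsilon> * (a \<bullet> a)" using \<open>q > 0\<close> by (simp add: e_def)
    finally have "quad_form X (f a) + s0 * quad_form X (g a) + sD * quad_form X (h a) \<le> (1 - e) * quad_form X a"
      using contr[of a] by (simp add: left_diff_distrib)
    also have "\<dots> \<le> r ^ Suc D * quad_form X a" by (intro mult_right_mono r_pow Xpos)
    finally show ?thesis .
  qed
  obtain \<gamma> where \<gamma>: "\<And>t a. Y t a \<le> \<gamma> t * (a \<bullet> a)" using bound by metis
  \<comment> \<open>Each summand alone dominates \<open>Y t\<close> at one of the unconstrained times.\<close>
  define c where "c = (\<Sum>t\<le>D. \<bar>\<gamma> t\<bar> / (\<epsilon> * r ^ t))"
  have "c \<ge> 0" using r \<open>\<epsilon> > 0\<close> by (auto simp: c_def intro!: sum_nonneg)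
  have decay: "Y t a \<le> c * r ^ t * quad_form X a" for t a
  proof (induction t arbitrary: a rule: less_induct)
    case (less t)
    show ?case
    proof (cases "t \<le> D")
      case True
      have "Y t a \<le> \<gamma> t * (a \<bullet> a)" by (rule \<gamma>)
      also have "\<dots> \<le> \<bar>\<gamma> t\<bar> * (a \<bullet> a)" by (intro mult_right_mono) auto
      also have "\<dots> = (\<bar>\<gamma> t\<bar> / (\<epsilon> * r ^ t)) * r ^ t * (\<epsilon> * (a \<bullet> a))"
        using r \<open>\<epsilon> > 0\<close> by (simp add: field_simps)
      also have "\<dots> \<le> c * r ^ t * quad_form X a"
      proof (intro mult_mono[OF mult_right_mono] coercive)
        show "\<bar>\<gamma> t\<bar> / (\<epsilon> * r ^ t) \<le> c"
          unfolding c_def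
        proof (rule member_le_sum)
          show "0 \<le> \<bar>\<gamma> s\<bar> / (\<epsilon> * r ^ s)" for s using r \<open>\<epsilon> > 0\<close> by simp
        qed (use True in simp_all)
      qed (use r \<open>c \<ge> 0\<close> \<open>\<epsilon> > 0\<close> in simp_all)
      finally show ?thesis .
    next
      case False
      then obtain s where t: "t = Suc s" and "D \<le> s" by (cases t) auto
      have IH: "Y s b \<le> c * r ^ (s - D) * quad_form X b" "Y (s - D) b \<le> c * r ^ (s - D) * quad_form X b" for b
      proof -
        have "Y s b \<le> c * r ^ s * quad_form X b" using less.IH[of s b] t by simp
        also have "\<dots> \<le> c * r ^ (s - D) * quad_form X b"
          using r \<open>c \<ge> 0\<close> Xpos by (intro mult_right_mono mult_left_mono power_decreasing) auto
        finally show "Y s b \<le> c * r ^ (s - D) * quad_form X b" .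
        show "Y (s - D) b \<le> c * r ^ (s - D) * quad_form X b" using less.IH[of "s - D" b] t by simp
      qed
      have "Y t a \<le> Y s (f a) + s0 * Y s (g a) + sD * Y (s - D) (h a)"
        using rec[OF \<open>D \<le> s\<close>] t by simp
      also have "\<dots> \<le> c * r ^ (s - D) * quad_form X (f a) + s0 * (c * r ^ (s - D) * quad_form X (g a))
          + sD * (c * r ^ (s - D) * quad_form X (h a))"
        using IH \<open>s0 \<ge> 0\<close> \<open>sD \<ge> 0\<close> by (intro add_mono mult_left_mono) auto
      also have "\<dots> = c * r ^ (s - D) * (quad_form X (f a) + s0 * quad_form X (g a) + sD * quad_form X (h a))"
        by (simp add: algebra_simps)
      also have "\<dots> \<le> c * r ^ (s - D) * (r ^ Suc D * quad_form X a)"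
        using r \<open>c \<ge> 0\<close> by (intro mult_left_mono contr') auto
      also have "\<dots> = c * (r ^ (s - D) * r ^ Suc D) * quad_form X a" by simp
      also have "r ^ (s - D) * r ^ Suc D = r ^ t"
        using \<open>D \<le> s\<close> t by (simp only: power_add[symmetric]) simp
      finally show ?thesis .
    qed
  qed
  show thesis
  proof (rule that[OF r])
    fix t a
    have "Y t a \<le> c * r ^ t * quad_form X a" by (rule decay)
    also have "\<dots> \<le> c * r ^ t * (q * (a \<bullet> a))"
      using r \<open>c \<ge> 0\<close> by (intro mult_left_mono q) auto
    finally show "Y t a \<le> c * q * r ^ t * (a \<bullet> a)" by (simp add: mult_ac)
  qed
qed

text \<open>
State and control path are built together. The second component stores the whole path, and at step
\<open>t\<close> only its value at time \<open>t\<close> is filled in, which later steps never change.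
\<close>

primrec closed_loop_run ::
  "(nat \<Rightarrow> 'x \<Rightarrow> (int \<Rightarrow> 'y) \<Rightarrow> 'y) \<Rightarrow> (nat \<Rightarrow> 'x \<Rightarrow> (int \<Rightarrow> 'y) \<Rightarrow> 'x) \<Rightarrow> 'x \<Rightarrow> (int \<Rightarrow> 'y)
    \<Rightarrow> nat \<Rightarrow> 'x \<times> (int \<Rightarrow> 'y)" where
  "closed_loop_run g f \<xi> \<phi> 0 = (\<xi>, \<phi>)"
| "closed_loop_run g f \<xi> \<phi> (Suc t) =
    (let (p, v) = closed_loop_run g f \<xi> \<phi> t; v' = v(int t := g t p v) in (f t p v', v'))"

text \<open>
Feedback law and state equation form a recursion as soon as \<open>g t\<close> reads the control path only before
time \<open>t\<close> and \<open>f t\<close> only up to time \<open>t\<close>.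
\<close>

lemma causal_recursion_exists:
  fixes g :: "nat \<Rightarrow> 'x \<Rightarrow> (int \<Rightarrow> 'y) \<Rightarrow> 'y" and f :: "nat \<Rightarrow> 'x \<Rightarrow> (int \<Rightarrow> 'y) \<Rightarrow> 'x"
  assumes g: "\<And>t p v v'. (\<And>s. s < int t \<Longrightarrow> v s = v' s) \<Longrightarrow> g t p v = g t p v'"
    and f: "\<And>t p v v'. (\<And>s. s \<le> int t \<Longrightarrow> v s = v' s) \<Longrightarrow> f t p v = f t p v'"
  shows "\<exists>x u. x 0 = \<xi> \<and> (\<forall>s<0. u s = \<phi> s) \<and> (\<forall>t. u (int t) = g t (x t) u) \<and>
    (\<forall>t. x (Suc t) = f t (x t) u)"
proof -
  let ?R = "closed_loop_run g f \<xi> \<phi>"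
  define x where "x t = fst (?R t)" for t
  define u where "u s = snd (?R (nat (s + 1))) s" for s
  have path_step: "snd (?R (Suc t)) = (snd (?R t))(int t := g t (x t) (snd (?R t)))" for t
    by (simp add: x_def Let_def case_prod_unfold)
  have x_step: "x (Suc t) = f t (x t) (snd (?R (Suc t)))" for t
    by (simp add: x_def Let_def case_prod_unfold)
  have stable: "snd (?R (t + k)) s = snd (?R t) s" if "s < int t" for t k s
    using that by (induction k) (simp_all add: path_step del: closed_loop_run.simps)
  have past: "snd (?R t) s = u s" if "s < int t" for t s
    using stable[of s "nat (s + 1)" "t - nat (s + 1)"] that by (simp add: u_def)
  have u: "u (int t) = g t (x t) u" for t
  proof -
    have "u (int t) = snd (?R (Suc t)) (int t)" by (simp add: u_def nat_add_distrib del: closed_loop_run.simps)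
    also have "\<dots> = g t (x t) (snd (?R t))" by (simp add: path_step del: closed_loop_run.simps)
    also have "\<dots> = g t (x t) u" by (intro g past)
    finally show ?thesis .
  qed
  have "x (Suc t) = f t (x t) u" for t
  proof -
    have "x (Suc t) = f t (x t) (snd (?R (Suc t)))" by (rule x_step)
    also have "\<dots> = f t (x t) u" by (intro f past) simp
    finally show ?thesis .
  qed
  moreover have "x 0 = \<xi>" "\<forall>s<0. u s = \<phi> s" by (auto simp: x_def u_def)
  ultimately show ?thesis using u by blast
qed

context noise_channels
begin

lemma closed_loop_exists:
  fixes A :: "real^'n^'n" and B G H :: "real^'m^'n"
  shows "\<exists>x u. closed_loop M w0 wD \<sigma>0 \<sigma>D A B G H D K0 K x u \<xi>0 \<phi>"
proof -
  define run where "run \<omega> x u \<longleftrightarrow> x 0 = \<xi>0 \<and> (\<forall>s<0. u s = \<phi> s) \<and>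
     (\<forall>t. u (int t) = K0 *v x t + (\<Sum>\<tau>=1..D. K \<tau> *v u (int t - int \<tau>))) \<and>
     (\<forall>t. x (Suc t) = delayed_dynamics A G B H w0 wD D t \<omega> (x t) u)" for \<omega> x u
  have "\<exists>x u. run \<omega> x u" for \<omega>
    unfolding run_def
    by (rule causal_recursion_exists[where g = "\<lambda>t p v. K0 *v p + (\<Sum>\<tau>=1..D. K \<tau> *v v (int t - int \<tau>))"])
      (auto simp: delayed_dynamics_def intro!: sum.cong)
  then obtain x u where "\<And>\<omega>. run \<omega> (x \<omega>) (u \<omega>)"
    by metis
  then have "closed_loop M w0 wD \<sigma>0 \<sigma>D A B G H D K0 K (\<lambda>t \<omega>. x \<omega> t) (\<lambda>s \<omega>. u \<omega> s) \<xi>0 \<phi>"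
    by (intro closed_loop.intro closed_loop_axioms.intro noise_channels_axioms) (auto simp: run_def feedback_law_def)
  then show ?thesis by blast
qed

end

context closed_loop
begin

text \<open>
The static law \<open>u = Kp y\<close> on the predictor is a feedback of the required form: the coefficient of
\<open>u (t - \<tau>)\<close> is \<open>Kp A^(\<tau> - 1) B\<close>.
\<close>

lemma predictor_feedback:
  assumes K0: "K0 = Kp ** mpow A D" and K: "\<And>\<tau>. K \<tau> = Kp ** mpow A (\<tau> - 1) ** B"
    and "\<omega> \<in> space M"
  shows "u (int t) \<omega> = Kp *v predictor t \<omega>"
proof -
  have "u (int t) \<omega> = K0 *v x t \<omega> + (\<Sum>\<tau>=1..D. K \<tau> *v u (int t - int \<tau>) \<omega>)"
    using feedback \<open>\<omega> \<in> space M\<close> by (simp add: feedback_law_def)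
  also have "(\<Sum>\<tau>=1..D. K \<tau> *v u (int t - int \<tau>) \<omega>)
      = (\<Sum>j<D. K (Suc j) *v u (int t - int (Suc j)) \<omega>)"
    by (simp add: sum.atLeast1_atMost_eq)
  also have "\<dots> = (\<Sum>j<D. Kp *v (mpow A j *v (B *v u (int t - 1 - int j) \<omega>)))"
    by (intro sum.cong) (auto simp: K matrix_vector_mul_assoc matrix_mul_assoc algebra_simps)
  finally show ?thesis
    by (simp add: predictor_def K0 matrix_vector_right_distrib linear_sum[OF matrix_vector_mul_linear]
        matrix_vector_mul_assoc matrix_mul_assoc)
qed

text \<open>
Since \<open>A^D\<close> is invertible, the state can be recovered from the predictor and the last \<open>D\<close> controls.
\<close>

lemma state_ms_null:
  assumes "invertible A" and pred: "ms_null predictor" and u: "ms_null (\<lambda>t. u (int t))"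
  shows "ms_null x"
proof -
  obtain Ai where Ai: "Ai ** mpow A D = mat 1"
    using invertible_mpow[OF assms(1)] unfolding invertible_def by blast
  let ?z = "\<lambda>t \<omega>. Ai *v (predictor t \<omega> + (\<Sum>j<D. (- (mpow A j ** B)) *v u (int t - 1 - int j) \<omega>))"
  have eq: "x t \<omega> = ?z t \<omega>" for t \<omega>
  proof -
    have "(\<Sum>j<D. (- (mpow A j ** B)) *v u (int t - 1 - int j) \<omega>)
       = - (\<Sum>j<D. mpow A j *v (B *v u (int t - 1 - int j) \<omega>))"
      by (simp add: matrix_vector_mul_assoc sum_negf uminus_matrix_vector)
    then have "?z t \<omega> = Ai *v (mpow A D *v x t \<omega>)" by (simp add: predictor_def)
    then show ?thesis by (simp add: matrix_vector_mul_assoc Ai)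
  qed
  have "ms_null ?z"
    by (intro ms_null_matrix ms_null_add pred ms_null_sum past_control_ms_null u) auto
  then show ?thesis by (rule ms_null_cong[THEN iffD2, rotated]) (rule eq)
qed

lemma control_measurable: "u (int t) \<in> borel_measurable (noise_filtration M w0 wD t)"
  unfolding noise_filtration_eq
  by (intro L2_vec_measurable L2_vec_mono[OF u_adapted history_mono]) auto

text \<open>
Under \<open>u = Kp y\<close> the second moments of the predictor satisfy the delayed recursion from time \<open>D\<close>
on and therefore decay geometrically. This makes the control square-summable and, through the
predictor, drives the state to zero.
\<close>

lemma gain_stabilizes:
  assumes "invertible A"
    and K0: "K0 = Kp ** mpow A D" and K: "\<And>\<tau>. K \<tau> = Kp ** mpow A (\<tau> - 1) ** B"
    and "\<epsilon> > 0" and coercive: "\<And>a. \<epsilon> * (a \<bullet> a) \<le> quad_form X a"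
    and contr: "\<And>a. quad_form X (a v* (A + B ** Kp)) + \<sigma>0\<^sup>2 * quad_form X (a v* ((mpow A D ** G) ** Kp))
      + \<sigma>D\<^sup>2 * quad_form X (a v* ((mpow A D ** H) ** Kp)) + \<epsilon> * (a \<bullet> a) \<le> quad_form X a"
  shows "admissible_control M w0 wD D K0 K x u" and "(\<lambda>t. mean_square M (x t)) \<longlonglongrightarrow> 0"
proof -
  note fb = predictor_feedback[OF K0 K]
  have u_second_moment: "second_moment (u (int t)) b = second_moment (predictor t) (b v* Kp)" for t b
    using second_moment_cong[of "u (int t)" "\<lambda>\<omega>. Kp *v predictor t \<omega>" b] fb by (simp add: second_moment_matrix)
  have rec: "second_moment (predictor (Suc t)) a \<le> second_moment (predictor t) (a v* (A + B ** Kp))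
     + \<sigma>0\<^sup>2 * second_moment (predictor t) (a v* ((mpow A D ** G) ** Kp))
     + \<sigma>D\<^sup>2 * second_moment (predictor (t - D)) (a v* ((mpow A D ** H) ** Kp))" if "D \<le> t" for t a
  proof -
    have "expectation (\<lambda>\<omega>. ((a v* A) \<bullet> predictor t \<omega> + (a v* B) \<bullet> u (int t) \<omega>)\<^sup>2)
      = second_moment (predictor t) (a v* (A + B ** Kp))"
      unfolding second_moment_def using fb
      by (intro Bochner_Integration.integral_cong)
        (auto simp: vector_matrix_mult_add_rdistrib inner_add_left vector_matrix_mul_assoc simp flip: dot_lmul_matrix)
    moreover have "int t - int D = int (t - D)" using that by simp
    ultimately show ?thesis
      using predictor_moment[of t a] by (simp add: u_second_moment vector_matrix_mul_assoc del: of_nat_diff)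
  qed
  obtain c r where r: "0 < r" "r < 1" and decay: "\<And>t a. second_moment (predictor t) a \<le> c * r ^ t * (a \<bullet> a)"
    using delayed_lyapunov_decay[of "\<lambda>t. second_moment (predictor t)", OF _ rec contr coercive \<open>\<epsilon> > 0\<close>]
      second_moment_le_norm_sq_mean[OF predictor_L2] by (metis zero_le_power2)
  obtain d where d: "\<And>b. (b v* Kp) \<bullet> (b v* Kp) \<le> d * (b \<bullet> b)"
    using vector_matrix_bound by blast
  have uL: "L2_vec UNIV (u (int t))" for t by (rule u_L2) simp
  have c: "0 \<le> c * r ^ t" for t
    using decay[of t "axis undefined 1"] order_trans[OF second_moment_nonneg[of "predictor t" "axis undefined 1"]]
    by (simp add: inner_axis_axis)
  have u_bound: "norm_sq_mean (u (int t)) \<le> (c * d * real CARD('m)) * r ^ t" for t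
  proof -
    have "norm_sq_mean (u (int t)) = (\<Sum>i\<in>UNIV. second_moment (predictor t) (axis i 1 v* Kp))"
      by (simp add: norm_sq_mean_eq_sum[OF uL] u_second_moment)
    also have "\<dots> \<le> (\<Sum>i\<in>(UNIV :: 'm set). c * r ^ t * d)"
    proof (intro sum_mono)
      fix i :: 'm
      have "second_moment (predictor t) (axis i 1 v* Kp) \<le> c * r ^ t * ((axis i 1 v* Kp) \<bullet> (axis i 1 v* Kp))"
        by (rule decay)
      also have "\<dots> \<le> c * r ^ t * (d * (axis i 1 \<bullet> (axis i 1 :: real^'m)))"
        by (intro mult_left_mono d c)
      finally show "second_moment (predictor t) (axis i 1 v* Kp) \<le> c * r ^ t * d" by (simp add: inner_axis_axis)
    qed
    finally show ?thesis by (simp add: mult_ac)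
  qed
  have geo: "summable (\<lambda>t. (c * d * real CARD('m)) * r ^ t)"
    using r by (intro summable_mult summable_geometric) auto
  have "summable (\<lambda>t. norm_sq_mean (u (int t)))"
    using u_bound by (intro summable_comparison_test'[OF geo]) auto
  then have sum: "(\<Sum>t. mean_square M (u (int t))) < \<infinity>"
    by (simp add: mean_square_eq_norm_sq_mean[OF uL] suminf_ennreal2 less_top[symmetric])
  with control_measurable feedback show "admissible_control M w0 wD D K0 K x u"
    by (simp add: admissible_control_def)
  have "ms_null predictor"
    unfolding ms_null_def
  proof (intro conjI allI predictor_L2)
    fix a :: "real^'n"
    have "(\<lambda>t. c * r ^ t * (a \<bullet> a)) \<longlonglongrightarrow> 0"
      using r by (intro tendsto_mult_left_zero tendsto_mult_right_zero LIMSEQ_realpow_zero) auto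
    then show "(\<lambda>t. second_moment (predictor t) a) \<longlonglongrightarrow> 0"
      by (rule Lim_null_comparison[OF always_eventually[OF allI], rotated]) (simp add: decay)
  qed
  then have "ms_null x"
    by (rule state_ms_null[OF assms(1) _ control_ms_null[OF sum]])
  then show "(\<lambda>t. mean_square M (x t)) \<longlonglongrightarrow> 0"
    by (simp add: ms_null_iff_mean_square x_L2)
qed

end

context noise_channels
begin

lemma moment_certificate_imp_stabilizable:
  fixes A :: "real^'n^'n" and B G H :: "real^'m^'n"
  assumes "invertible A"
    and "moment_certificate A B (mpow A D ** G) (mpow A D ** H) (\<sigma>0\<^sup>2) (\<sigma>D\<^sup>2)"
  shows "delayed_stabilizable M w0 wD A G B H D"
proof -
  obtain X Kp \<epsilon> where gain: "\<epsilon> > 0" "\<And>a. \<epsilon> * (a \<bullet> a) \<le> quad_form X a"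
    "\<And>a. quad_form X (a v* (A + B ** Kp)) + \<sigma>0\<^sup>2 * quad_form X (a v* ((mpow A D ** G) ** Kp))
      + \<sigma>D\<^sup>2 * quad_form X (a v* ((mpow A D ** H) ** Kp)) + \<epsilon> * (a \<bullet> a) \<le> quad_form X a"
    using moment_certificate_imp_gain[OF assms(2)] by (metis zero_le_power2)
  define K0 where "K0 = Kp ** mpow A D"
  define K where "K = (\<lambda>\<tau>. Kp ** mpow A (\<tau> - 1) ** B)"
  show ?thesis
    unfolding delayed_stabilizable_def ms_stabilizable_def
  proof (rule exI[of _ K0], rule exI[of _ K], intro allI)
    fix \<xi>0 :: "real^'n" and \<phi> :: "int \<Rightarrow> real^'m"
    obtain x u where cl: "closed_loop M w0 wD \<sigma>0 \<sigma>D A B G H D K0 K x u \<xi>0 \<phi>"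
      using closed_loop_exists by blast
    interpret closed_loop M w0 wD \<sigma>0 \<sigma>D A B G H D K0 K x u \<xi>0 \<phi> by (rule cl)
    show "\<exists>x u. (\<forall>\<omega>\<in>space M. x 0 \<omega> = \<xi>0) \<and>
            (\<forall>s\<in>{- int D..-1}. \<forall>\<omega>\<in>space M. u s \<omega> = \<phi> s) \<and>
            (\<forall>t. \<forall>\<omega>\<in>space M. x (Suc t) \<omega> = delayed_dynamics A G B H w0 wD D t \<omega> (x t \<omega>) (\<lambda>s. u s \<omega>)) \<and>
            admissible_control M w0 wD D K0 K x u \<and>
            (\<lambda>t. mean_square M (x t)) \<longlonglongrightarrow> 0"
      using gain_stabilizes[OF assms(1) K0_def K_def[THEN fun_cong] gain]
        initial_state initial_control dynamics
      by (intro exI[of _ x] exI[of _ u]) auto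
  qed
qed

section \<open>Monotonicity in the delay and the margin\<close>

theorem delayed_stabilizable_iff_certificate:
  fixes A :: "real^'n^'n" and B G H :: "real^'m^'n"
  assumes "invertible A"
  shows "delayed_stabilizable M w0 wD A G B H D \<longleftrightarrow>
    moment_certificate A B (mpow A D ** G) (mpow A D ** H) (\<sigma>0\<^sup>2) (\<sigma>D\<^sup>2)"
  using assms moment_certificate_imp_stabilizable stabilizable_imp_moment_certificate by blast

text \<open>
The noise directions at delay \<open>D + 1\<close> are those at delay \<open>D\<close> multiplied by \<open>A\<close>, so one step down in
the delay is one use of the waiting argument.
\<close>

lemma delayed_stabilizable_mono:
  fixes A :: "real^'n^'n" and B G H :: "real^'m^'n"
  assumes "invertible A" "delayed_stabilizable M w0 wD A G B H D" "D' \<le> D"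
  shows "delayed_stabilizable M w0 wD A G B H D'"
  using assms(3,2)
proof (induction rule: inc_induct)
  case (step k)
  then have "moment_certificate A B (A ** (mpow A k ** G)) (A ** (mpow A k ** H)) (\<sigma>0\<^sup>2) (\<sigma>D\<^sup>2)"
    by (simp add: delayed_stabilizable_iff_certificate[OF assms(1)] matrix_mul_assoc)
  then show ?case
    by (simp add: delayed_stabilizable_iff_certificate[OF assms(1)] moment_certificate_of_propagated_noise)
qed

end

lemma downward_closed_enat_threshold:
  fixes P :: "nat \<Rightarrow> bool"
  assumes "P 0" and down: "\<And>m n. P n \<Longrightarrow> m \<le> n \<Longrightarrow> P m"
  shows "\<exists>!N::enat. (\<forall>n. enat n \<le> N \<longrightarrow> P n) \<and> (\<forall>n. enat n > N \<longrightarrow> \<not> P n)"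
proof (rule ex_ex1I)
  show "\<exists>N. (\<forall>n. enat n \<le> N \<longrightarrow> P n) \<and> (\<forall>n. enat n > N \<longrightarrow> \<not> P n)"
  proof (cases "\<forall>n. P n")
    case True then show ?thesis by (intro exI[of _ \<infinity>]) auto
  next
    case False
    define m where "m = (LEAST n. \<not> P n)"
    have m: "\<not> P m" "\<And>n. n < m \<Longrightarrow> P n"
      unfolding m_def using False LeastI_ex[of "\<lambda>n. \<not> P n"] not_less_Least by blast+
    with \<open>P 0\<close> obtain k where k: "m = Suc k" by (cases m) auto
    then show ?thesis using m down by (intro exI[of _ "enat k"]) (auto simp: less_Suc_eq_le Suc_le_eq)
  qed
next
  fix N N' :: enat
  let ?Q = "\<lambda>N. (\<forall>n. enat n \<le> N \<longrightarrow> P n) \<and> (\<forall>n. enat n > N \<longrightarrow> \<not> P n)"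
  have not_less: "\<not> N < N'" if "?Q N" "?Q N'" for N N'
  proof
    assume "N < N'"
    then obtain k where k: "N = enat k" by (cases N) auto
    with \<open>N < N'\<close> have "enat (Suc k) \<le> N'" by (simp add: Suc_ile_eq)
    with that k show False by auto
  qed
  assume "?Q N" "?Q N'"
  then show "N = N'" using not_less by (metis linorder_neqE)
qed

theorem theorem3:
  fixes M :: "'a measure"
    and w0 wD :: "nat \<Rightarrow> 'a \<Rightarrow> real"
    and \<sigma>0 \<sigma>D :: real
    and A :: "real^'n^'n"
    and C0 B C :: "real^'m^'n"
  assumes "noise_channels M w0 wD \<sigma>0 \<sigma>D"
    and "invertible A"
    and "unstable A"
    and "delayed_stabilizable M w0 wD A C0 B C 0"
    and "\<not> delay_free_stabilizable M w0 wD A C0"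
  shows "\<exists>!Dmax::enat.
           (\<forall>D::nat. enat D \<le> Dmax \<longrightarrow> delayed_stabilizable M w0 wD A C0 B C D) \<and>
           (\<forall>D::nat. enat D > Dmax \<longrightarrow> \<not> delayed_stabilizable M w0 wD A C0 B C D)"
  using assms(4) noise_channels.delayed_stabilizable_mono[OF assms(1,2)]
  by (rule downward_closed_enat_threshold)

end
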